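(* Let $\mathcal H$ be a real separable Hilbert space with closed unit ball $B$, let $(\Omega,\mathcal F,\mathbb P)$ be a probability space with filtration $(\mathcal F_n)_{n\in\mathbb N}$, let $(X_n)_{n\ge 1}$ be a predictable $B$-valued sequence, and let $(Y_n)_{n\ge 1}$ be an adapted real-valued sequence with $\mathbb E[Y_n\mid\mathcal F_{n-1}]=0$ and $|Y_n|\le 1$ almost surely for all $n\ge1$. Define $M_n=\sum_{j=1}^n Y_jX_j$, $Q_n=\sum_{j=1}^n\mathbb E[Y_j^2\mid\mathcal F_{j-1}]\,X_j\otimes X_j$, $V_n=\sum_{j=1}^n X_j\otimes X_j$ and, for $\rho\ge1$, $Z_n(\rho)=\|(Q_n+\rho I)^{-1/2}M_n\|$. Let $$\gamma^\star_n=\inf\{\rho\ge1:\ \rho\ge\gamma(\rho^{-1}V_n)\},\qquad Z^\star_n=Z_n(\gamma^\star_n),\qquad \iota_n=1+\log\log(en).$$ Then for all $y>0$, $$\mathbb P\left[\exists n\ge 1:\ Z^\star_n>100\left(\sqrt{\gamma^\star_n+y+\iota_n}+\frac{y+\iota_n}{\sqrt{\gamma^\star_n}}\right)\right]\le e^{-y}.$$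
   Context: $\mathbb N=\{0,1,2,\dots\}$. Predictable means $X_n$ is $\mathcal F_{n-1}$-measurable for each $n\ge1$; adapted means $Y_n$ is $\mathcal F_n$-measurable. $I$ is the identity operator on $\mathcal H$, and $x\otimes x$ is the rank-one operator $z\mapsto\langle x,z\rangle x$. For a positive semidefinite trace class operator $A$ on $\mathcal H$, the information gain is $\gamma(A)=\tfrac12\log\det(I+A)$, where $\det$ is the Fredholm determinant. In $\log\log(en)$, $e$ is Euler's number. *)

theory Defs
  imports "HOL-Probability.Probability"
begin

lift_definition rank_one :: "'a::real_inner \<Rightarrow> 'a \<Rightarrow>\<^sub>L 'a"
  is "\<lambda>x z. (x \<bullet> z) *\<^sub>R x"
  by (intro bounded_linear_intros)

definition positive_op :: "('a::real_inner \<Rightarrow>\<^sub>L 'a) \<Rightarrow> bool" where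
  "positive_op A \<longleftrightarrow>
     (\<forall>x y. blinfun_apply A x \<bullet> y = x \<bullet> blinfun_apply A y) \<and>
     (\<forall>x. 0 \<le> blinfun_apply A x \<bullet> x)"

definition op_inverse :: "('a::real_normed_vector \<Rightarrow>\<^sub>L 'a) \<Rightarrow> ('a \<Rightarrow>\<^sub>L 'a)" where
  "op_inverse A = (THE B. A o\<^sub>L B = id_blinfun \<and> B o\<^sub>L A = id_blinfun)"

definition op_sqrt :: "('a::real_inner \<Rightarrow>\<^sub>L 'a) \<Rightarrow> ('a \<Rightarrow>\<^sub>L 'a)" where
  "op_sqrt A = (THE B. positive_op B \<and> B o\<^sub>L B = A)"

definition orthonormal_basis :: "'a::real_inner set \<Rightarrow> bool" where
  "orthonormal_basis E \<longleftrightarrow>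
     pairwise orthogonal E \<and> (\<forall>e\<in>E. norm e = 1) \<and> closure (span E) = UNIV"

text \<open>The determinant of the matrix of entries \<open>e \<bullet> A f\<close> for \<open>e, f \<in> S\<close>,
  where \<open>S\<close> is a finite set of vectors.\<close>

definition principal_minor :: "('a::real_inner \<Rightarrow>\<^sub>L 'a) \<Rightarrow> 'a set \<Rightarrow> real" where
  "principal_minor A S =
     (\<Sum>\<pi> | \<pi> permutes S. of_int (sign \<pi>) * (\<Prod>e\<in>S. e \<bullet> blinfun_apply A (\<pi> e)))"

text \<open>\<open>fredholm_det A\<close> is the Fredholm determinant of \<open>I + A\<close>, for \<open>A\<close> of trace class:
  the Fredholm series \<open>\<Sum>k. tr (\<Lambda>\<^sup>k A)\<close>, where \<open>tr (\<Lambda>\<^sup>k A)\<close>, computed in the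
  basis of \<open>\<Lambda>\<^sup>k H\<close> induced by an orthonormal basis \<open>E\<close> of \<open>H\<close>, is the sum of the
  principal minors of \<open>A\<close> over the \<open>k\<close>-element subsets of \<open>E\<close>. The series converges
  absolutely, and its value does not depend on \<open>E\<close>.\<close>

definition fredholm_det :: "('a::real_inner \<Rightarrow>\<^sub>L 'a) \<Rightarrow> real" where
  "fredholm_det A =
     (let E = (SOME E. orthonormal_basis E)
      in \<Sum>\<^sub>\<infinity>S\<in>{S. finite S \<and> S \<subseteq> E}. principal_minor A S)"

definition info_gain :: "('a::real_inner \<Rightarrow>\<^sub>L 'a) \<Rightarrow> real" where
  "info_gain A = 1 / 2 * ln (fredholm_det A)"

definition M_sum :: "(nat \<Rightarrow> 'w \<Rightarrow> 'a) \<Rightarrow> (nat \<Rightarrow> 'w \<Rightarrow> real) \<Rightarrow> nat \<Rightarrow> 'w \<Rightarrow> 'a::real_inner" where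
  "M_sum X Y n \<omega> = (\<Sum>j=1..n. Y j \<omega> *\<^sub>R X j \<omega>)"

text \<open>For the nonnegative variable \<open>Y\<^sub>j\<^sup>2\<close> we use the conditional expectation
  \<open>nn_cond_exp\<close>: unlike \<open>real_cond_exp\<close> it yields a version that is nonnegative
  everywhere, so that \<open>Q_op\<close> is positive at every sample point.\<close>

definition cond_sq ::
  "'w measure \<Rightarrow> (nat \<Rightarrow> 'w measure) \<Rightarrow> (nat \<Rightarrow> 'w \<Rightarrow> real) \<Rightarrow> nat \<Rightarrow> 'w \<Rightarrow> real" where
  "cond_sq P F Y j \<omega> = enn2real (nn_cond_exp P (F (j - 1)) (\<lambda>\<omega>. ennreal ((Y j \<omega>)\<^sup>2)) \<omega>)"

definition Q_op ::
  "'w measure \<Rightarrow> (nat \<Rightarrow> 'w measure) \<Rightarrow> (nat \<Rightarrow> 'w \<Rightarrow> 'a) \<Rightarrow> (nat \<Rightarrow> 'w \<Rightarrow> real)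
     \<Rightarrow> nat \<Rightarrow> 'w \<Rightarrow> ('a::real_inner \<Rightarrow>\<^sub>L 'a)" where
  "Q_op P F X Y n \<omega> = (\<Sum>j=1..n. cond_sq P F Y j \<omega> *\<^sub>R rank_one (X j \<omega>))"

definition V_op :: "(nat \<Rightarrow> 'w \<Rightarrow> 'a) \<Rightarrow> nat \<Rightarrow> 'w \<Rightarrow> ('a::real_inner \<Rightarrow>\<^sub>L 'a)" where
  "V_op X n \<omega> = (\<Sum>j=1..n. rank_one (X j \<omega>))"

definition Z_norm ::
  "'w measure \<Rightarrow> (nat \<Rightarrow> 'w measure) \<Rightarrow> (nat \<Rightarrow> 'w \<Rightarrow> 'a::real_inner) \<Rightarrow> (nat \<Rightarrow> 'w \<Rightarrow> real)
     \<Rightarrow> nat \<Rightarrow> real \<Rightarrow> 'w \<Rightarrow> real" where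
  "Z_norm P F X Y n \<rho> \<omega> =
     norm (blinfun_apply (op_sqrt (op_inverse (Q_op P F X Y n \<omega> + \<rho> *\<^sub>R id_blinfun)))
             (M_sum X Y n \<omega>))"

definition gamma_star :: "(nat \<Rightarrow> 'w \<Rightarrow> 'a::real_inner) \<Rightarrow> nat \<Rightarrow> 'w \<Rightarrow> real" where
  "gamma_star X n \<omega> = Inf {\<rho>. \<rho> \<ge> 1 \<and> \<rho> \<ge> info_gain (inverse \<rho> *\<^sub>R V_op X n \<omega>)}"

definition Z_star ::
  "'w measure \<Rightarrow> (nat \<Rightarrow> 'w measure) \<Rightarrow> (nat \<Rightarrow> 'w \<Rightarrow> 'a::real_inner) \<Rightarrow> (nat \<Rightarrow> 'w \<Rightarrow> real)
     \<Rightarrow> nat \<Rightarrow> 'w \<Rightarrow> real" where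
  "Z_star P F X Y n \<omega> = Z_norm P F X Y n (gamma_star X n \<omega>) \<omega>"

definition iota :: "nat \<Rightarrow> real" where
  "iota n = 1 + ln (ln (exp 1 * real n))"

end

(*
For fixed r put R_n = (Q_n + r I)^-1, w = <X_n, R_(n-1) X_n>, a = <X_n, R_(n-1) M_(n-1)> and
s = E[Y_n^2 | F_(n-1)]. The Sherman-Morrison formula gives
  Z_n(r)^2 = Z_(n-1)(r)^2 + (2 Y_n a - s a^2 + Y_n^2 w) / (1 + s w).
As a^2 <= w Z_(n-1)(r)^2, the increment is bounded as long as Z(r) <= K, so for small eta the process
exp (eta Z_n(r)^2 - 9/8 eta (sum of ln (1 + s w))), stopped when Z(r) exceeds K, is a supermartingale:
the drift - s a^2 absorbs the variance of 2 Y_n a. By the matrix determinant lemma the compensating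
sum is ln det (I + Q_n / r) <= 2 gamma(V_n / r), which is at most 2 r when gamma(V_n / r) <= r.
Markov's inequality bounds the probability that Z(r) exceeds K while gamma(V_n / r) <= r, and a
union bound over r = 2^(k+1) handles the random gamma*: if 2^k <= gamma* < 2^(k+1), then passing from
gamma* to r costs a factor 2 in Z^2, and n >= 4^k since gamma* <= max 1 (sqrt (n/2)), which is
why iota n pays for the union bound.
*)
theory Submission
  imports Defs "Jordan_Normal_Form.Determinant"
begin

no_notation scalar_prod (infix "\<bullet>" 70)
hide_const (open) Matrix.orthogonal
hide_fact (open) Matrix.orthogonal_def

section \<open>Resolvents of finite rank operators\<close>

text \<open>The definitions give an inverse and a square root by unique choice and a determinant as
  a series over an arbitrarily chosen basis; none of them can be estimated or measured before it is
  identified. All are reduced to one recursively defined resolvent: Z_n(\<rho>)^2 is its quadratic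
  form at M_n, and the Fredholm series equals a finite product of scalars formed from it, reached
  through compressions to finite parts of the basis. Stopping is forced because |a| can grow with Z,
  whereas the bound exp t <= 1 + t + t^2 needs increments of size at most 1. With q a bound on the
  unscaled increment while Z <= K, the rate is \<eta> = min (1/8) (1/q). For \<eta> = 1/8 the
  square-root term of the threshold suffices; for \<eta> = 1/q the linear term pays for the large
  increments. In 9/8, the 1 pays for the mean of Y_n^2 w and the 1/8 for its second-order
  contribution.\<close>

lemma rank_one_apply [simp]: "blinfun_apply (rank_one x) z = (x \<bullet> z) *\<^sub>R x"
  by (simp add: rank_one.rep_eq)

lemma positive_op_sym: "positive_op A \<Longrightarrow> blinfun_apply A x \<bullet> y = x \<bullet> blinfun_apply A y"
  and positive_op_nonneg: "positive_op A \<Longrightarrow> 0 \<le> blinfun_apply A x \<bullet> x"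
  by (auto simp: positive_op_def)

lemma positive_op_add: "positive_op A \<Longrightarrow> positive_op B \<Longrightarrow> positive_op (A + B)"
  by (auto simp: positive_op_def blinfun.add_left inner_add_left inner_add_right)

lemma positive_op_scaleR: "positive_op A \<Longrightarrow> 0 \<le> c \<Longrightarrow> positive_op (c *\<^sub>R A)"
  by (auto simp: positive_op_def blinfun.scaleR_left)

lemma positive_op_zero: "positive_op 0"
  by (auto simp: positive_op_def)

lemma positive_op_id: "positive_op id_blinfun"
  by (auto simp: positive_op_def)

lemma positive_op_rank_one: "positive_op (rank_one x)"
  by (auto simp: positive_op_def inner_commute)

lemma positive_op_sum:
  "(\<And>i. i \<in> I \<Longrightarrow> positive_op (A i)) \<Longrightarrow> positive_op (sum A I)"
  by (induction I rule: infinite_finite_induct) (auto intro: positive_op_add positive_op_zero)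

text \<open>Discriminant argument: the form of \<open>A\<close> is nonnegative along the line
  through \<open>x\<close> in direction \<open>y\<close>. It may degenerate, so \<open>q = 0\<close>
  is treated apart.\<close>

lemma positive_op_Cauchy_Schwarz:
  assumes "positive_op A"
  shows "(blinfun_apply A x \<bullet> y)\<^sup>2 \<le> (blinfun_apply A x \<bullet> x) * (blinfun_apply A y \<bullet> y)"
proof -
  define p q t where "p = blinfun_apply A x \<bullet> x" and "q = blinfun_apply A y \<bullet> y"
    and "t = blinfun_apply A x \<bullet> y"
  have t': "blinfun_apply A y \<bullet> x = t"
    unfolding t_def using positive_op_sym[OF assms, of y x] by (simp add: inner_commute)
  have quad: "0 \<le> p + 2 * s * t + s\<^sup>2 * q" for s
  proof -
    have "0 \<le> blinfun_apply A (x + s *\<^sub>R y) \<bullet> (x + s *\<^sub>R y)"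
      by (rule positive_op_nonneg[OF assms])
    also have "\<dots> = p + 2 * s * t + s\<^sup>2 * q"
      using t' unfolding p_def q_def t_def
      by (simp add: blinfun.bilinear_simps inner_add_left inner_add_right power2_eq_square
          algebra_simps)
    finally show ?thesis .
  qed
  have q0: "0 \<le> q" unfolding q_def by (rule positive_op_nonneg[OF assms])
  have p0: "0 \<le> p" unfolding p_def by (rule positive_op_nonneg[OF assms])
  have "t\<^sup>2 \<le> p * q"
  proof (cases "q = 0")
    case True
    have "t = 0"
    proof (rule ccontr)
      assume "t \<noteq> 0"
      \<comment> \<open>With \<open>q = 0\<close> the quadratic is affine in \<open>s\<close>; this
        \<open>s\<close> brings its value down to -1.\<close>
      then have "p + 2 * (- (p + 1) / (2 * t)) * t = - 1" by (simp add: field_simps)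
      with quad[of "- (p + 1) / (2 * t)"] True show False by simp
    qed
    then show ?thesis using True by simp
  next
    case False
    then have q: "0 < q" using q0 by simp
    have "0 \<le> p - t\<^sup>2 / q"
      using quad[of "- t / q"] q by (simp add: field_simps power2_eq_square)
    then show ?thesis using q by (simp add: field_simps)
  qed
  then show ?thesis unfolding p_def q_def t_def .
qed

text \<open>Common form of \<open>Q_op\<close> (weights: conditional variances) and of
  \<open>V_op\<close> divided by \<rho> (constant weights), so that resolvents and determinants are
  treated once for both.\<close>

definition weighted_sum :: "(nat \<Rightarrow> real) \<Rightarrow> (nat \<Rightarrow> 'a::real_inner) \<Rightarrow> nat \<Rightarrow> ('a \<Rightarrow>\<^sub>L 'a)" where
  "weighted_sum c x n = (\<Sum>j=1..n. c j *\<^sub>R rank_one (x j))"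

lemma weighted_sum_0 [simp]: "weighted_sum c x 0 = 0"
  by (simp add: weighted_sum_def)

lemma weighted_sum_Suc:
  "weighted_sum c x (Suc n) = weighted_sum c x n + c (Suc n) *\<^sub>R rank_one (x (Suc n))"
  by (simp add: weighted_sum_def)

lemma positive_op_weighted_sum: "(\<And>j. 0 \<le> c j) \<Longrightarrow> positive_op (weighted_sum c x n)"
  unfolding weighted_sum_def
  by (intro positive_op_sum positive_op_scaleR positive_op_rank_one)

text \<open>The inverse of \<open>weighted_sum c x n + \<rho> I\<close>, computed by the Sherman--Morrison formula;
  this form makes measurability and continuity in \<open>x\<close> and \<open>c\<close> accessible by induction.\<close>

primrec resolv :: "real \<Rightarrow> (nat \<Rightarrow> real) \<Rightarrow> (nat \<Rightarrow> 'a::real_inner) \<Rightarrow> nat \<Rightarrow> ('a \<Rightarrow>\<^sub>L 'a)" where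
  "resolv \<rho> c x 0 = (1 / \<rho>) *\<^sub>R id_blinfun"
| "resolv \<rho> c x (Suc n) = resolv \<rho> c x n -
     (c (Suc n) / (1 + c (Suc n) * (x (Suc n) \<bullet> blinfun_apply (resolv \<rho> c x n) (x (Suc n)))))
       *\<^sub>R rank_one (blinfun_apply (resolv \<rho> c x n) (x (Suc n)))"

text \<open>Put v = R u: then <R u, u> = <A v, v> + \<rho> |v|^2. Isolated because the next
  induction needs it at a stage where only symmetry and the right inverse are known.\<close>

lemma positive_op_of_right_inverse:
  assumes "positive_op A" "0 \<le> \<rho>"
    and sym: "\<And>u v. blinfun_apply R u \<bullet> v = u \<bullet> blinfun_apply R v"
    and inv: "\<And>u. blinfun_apply A (blinfun_apply R u) + \<rho> *\<^sub>R blinfun_apply R u = u"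
  shows "positive_op R"
  unfolding positive_op_def
proof (intro conjI allI)
  fix u
  have "0 \<le> blinfun_apply A (blinfun_apply R u) \<bullet> blinfun_apply R u
      + \<rho> * (blinfun_apply R u \<bullet> blinfun_apply R u)"
    using assms(2) positive_op_nonneg[OF assms(1)] by simp
  also have "\<dots> = (blinfun_apply A (blinfun_apply R u) + \<rho> *\<^sub>R blinfun_apply R u) \<bullet> blinfun_apply R u"
    by (simp add: inner_add_left)
  also have "\<dots> = blinfun_apply R u \<bullet> u"
    unfolding inv by (rule inner_commute)
  finally show "0 \<le> blinfun_apply R u \<bullet> u" .
qed (rule sym)

text \<open>Both claims go through one induction: symmetry turns z . R u into R z . u in the update,
  and together they make R positive, which keeps the denominator 1 + c w away from 0.\<close>

lemma resolv_sym_right_inverse: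
  fixes x :: "nat \<Rightarrow> 'a::real_inner"
  assumes c: "\<And>j. 0 \<le> c j" and \<rho>: "0 < \<rho>"
  shows "(\<forall>u v. blinfun_apply (resolv \<rho> c x n) u \<bullet> v = u \<bullet> blinfun_apply (resolv \<rho> c x n) v) \<and>
    (\<forall>u. blinfun_apply (weighted_sum c x n) (blinfun_apply (resolv \<rho> c x n) u)
       + \<rho> *\<^sub>R blinfun_apply (resolv \<rho> c x n) u = u)"
proof (induction n)
  case 0
  show ?case using \<rho> by (simp add: blinfun.scaleR_left)
next
  case (Suc n)
  define R where "R = blinfun_apply (resolv \<rho> c x n)"
  define A where "A = blinfun_apply (weighted_sum c x n)"
  define z where "z = x (Suc n)"
  define w where "w = z \<bullet> R z"
  define k where "k = c (Suc n) / (1 + c (Suc n) * w)"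
  have sym: "R u \<bullet> v = u \<bullet> R v" and inv: "A (R u) + \<rho> *\<^sub>R R u = u" for u v
    using Suc.IH unfolding R_def A_def by auto
  have "positive_op (resolv \<rho> c x n)"
    by (rule positive_op_of_right_inverse[OF positive_op_weighted_sum[OF c], of \<rho>])
      (use sym inv \<rho> in \<open>auto simp: R_def A_def\<close>)
  then have w: "0 \<le> w"
    unfolding w_def R_def using positive_op_nonneg[of "resolv \<rho> c x n" z] by (simp add: inner_commute)
  then have pos: "0 < 1 + c (Suc n) * w" using c[of "Suc n"] by (simp add: add_pos_nonneg)
  have k: "k * (1 + c (Suc n) * w) = c (Suc n)" using pos unfolding k_def by simp
  have app: "blinfun_apply (resolv \<rho> c x (Suc n)) u = R u - (k * (R z \<bullet> u)) *\<^sub>R R z" for u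
    by (simp add: blinfun.bilinear_simps R_def[symmetric] z_def[symmetric] k_def w_def)
  have A': "blinfun_apply (weighted_sum c x (Suc n)) u = A u + (c (Suc n) * (z \<bullet> u)) *\<^sub>R z" for u
    by (simp add: weighted_sum_Suc blinfun.bilinear_simps A_def[symmetric] z_def[symmetric])
  show ?case
  proof (intro conjI allI)
    fix u v
    show "blinfun_apply (resolv \<rho> c x (Suc n)) u \<bullet> v = u \<bullet> blinfun_apply (resolv \<rho> c x (Suc n)) v"
      unfolding app using sym[of u v] by (simp add: inner_diff_left inner_diff_right inner_commute)
  next
    fix u
    define t where "t = R z \<bullet> u"
    have t: "z \<bullet> R u = t" unfolding t_def using sym[of z u] by simp
    have lin: "A (R u - (k * t) *\<^sub>R R z) = A (R u) - (k * t) *\<^sub>R A (R z)"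
      unfolding A_def by (simp add: blinfun.bilinear_simps)
    have "blinfun_apply (weighted_sum c x (Suc n)) (blinfun_apply (resolv \<rho> c x (Suc n)) u)
        + \<rho> *\<^sub>R blinfun_apply (resolv \<rho> c x (Suc n)) u
      = (A (R u) + \<rho> *\<^sub>R R u) - (k * t) *\<^sub>R (A (R z) + \<rho> *\<^sub>R R z)
        + (c (Suc n) * (t - k * t * w)) *\<^sub>R z"
      unfolding app A' t_def[symmetric] lin
      by (simp add: inner_diff_right t w_def algebra_simps)
    also have "\<dots> = u + (c (Suc n) * t - t * (k * (1 + c (Suc n) * w))) *\<^sub>R z"
      unfolding inv by (simp add: algebra_simps)
    also have "\<dots> = u" unfolding k by simp
    finally show "blinfun_apply (weighted_sum c x (Suc n)) (blinfun_apply (resolv \<rho> c x (Suc n)) u)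
        + \<rho> *\<^sub>R blinfun_apply (resolv \<rho> c x (Suc n)) u = u" .
  qed
qed

context
  fixes c :: "nat \<Rightarrow> real" and \<rho> :: real
  assumes c: "\<And>j. 0 \<le> c j" and \<rho>: "0 < \<rho>"
begin

lemma resolv_sym: "blinfun_apply (resolv \<rho> c x n) u \<bullet> v = u \<bullet> blinfun_apply (resolv \<rho> c x n) v"
  by (rule resolv_sym_right_inverse[OF c \<rho>, THEN conjunct1, rule_format])

lemma resolv_right_inverse:
  "blinfun_apply (weighted_sum c x n) (blinfun_apply (resolv \<rho> c x n) u)
    + \<rho> *\<^sub>R blinfun_apply (resolv \<rho> c x n) u = u"
  by (rule resolv_sym_right_inverse[OF c \<rho>, THEN conjunct2, rule_format])

text \<open>Both factors are symmetric, so this is the adjoint of the right inverse identity; hence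
  the test against arbitrary \<open>v\<close>.\<close>

lemma resolv_left_inverse:
  "blinfun_apply (resolv \<rho> c x n) (blinfun_apply (weighted_sum c x n) u + \<rho> *\<^sub>R u) = u"
proof -
  let ?R = "blinfun_apply (resolv \<rho> c x n)" and ?A = "blinfun_apply (weighted_sum c x n)"
  have A: "?A a \<bullet> b = a \<bullet> ?A b" for a b
    by (rule positive_op_sym[OF positive_op_weighted_sum[OF c]])
  have "?R (?A u + \<rho> *\<^sub>R u) \<bullet> v = u \<bullet> v" for v
  proof -
    have "?R (?A u + \<rho> *\<^sub>R u) \<bullet> v = u \<bullet> (?A (?R v) + \<rho> *\<^sub>R ?R v)"
      by (simp add: resolv_sym inner_add_left inner_add_right A)
    then show ?thesis by (simp add: resolv_right_inverse)
  qed
  then show ?thesis by (metis vector_eq_rdot)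
qed

lemma positive_op_resolv: "positive_op (resolv \<rho> c x n)"
  by (rule positive_op_of_right_inverse[OF positive_op_weighted_sum[OF c], of \<rho>])
    (use \<rho> resolv_sym resolv_right_inverse in auto)

lemma resolv_form_nonneg: "0 \<le> u \<bullet> blinfun_apply (resolv \<rho> c x n) u"
  using positive_op_nonneg[OF positive_op_resolv] by (simp add: inner_commute)

text \<open>With v = R u, positivity gives \<rho> |v|^2 <= <u, v> <= |u| |v|, hence |v| <= |u| /
  \<rho>.\<close>

lemma resolv_form_le: "u \<bullet> blinfun_apply (resolv \<rho> c x n) u \<le> (norm u)\<^sup>2 / \<rho>"
proof -
  let ?v = "blinfun_apply (resolv \<rho> c x n) u"
  have "\<rho> * (norm ?v)\<^sup>2 \<le> blinfun_apply (weighted_sum c x n) ?v \<bullet> ?v + \<rho> * (?v \<bullet> ?v)"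
    using positive_op_nonneg[OF positive_op_weighted_sum[OF c]] by (simp add: power2_norm_eq_inner)
  also have "\<dots> = (blinfun_apply (weighted_sum c x n) ?v + \<rho> *\<^sub>R ?v) \<bullet> ?v"
    by (simp add: inner_add_left)
  also have "\<dots> = u \<bullet> ?v" by (simp only: resolv_right_inverse)
  finally have 1: "\<rho> * (norm ?v)\<^sup>2 \<le> u \<bullet> ?v" .
  have 2: "u \<bullet> ?v \<le> norm u * norm ?v" by (rule norm_cauchy_schwarz)
  have "norm ?v \<le> norm u / \<rho>"
  proof (cases "norm ?v = 0")
    case False
    have "\<rho> * norm ?v * norm ?v \<le> norm u * norm ?v" using 1 2 by (simp add: power2_eq_square)
    then have "\<rho> * norm ?v \<le> norm u" using False by simp
    then show ?thesis using \<rho> by (simp add: field_simps)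
  qed (use \<rho> in simp)
  then have "norm u * norm ?v \<le> norm u * (norm u / \<rho>)" by (intro mult_left_mono) auto
  then show ?thesis using 2 by (simp add: power2_eq_square)
qed

lemma op_inverse_weighted_sum: "op_inverse (weighted_sum c x n + \<rho> *\<^sub>R id_blinfun) = resolv \<rho> c x n"
proof -
  have 1: "(weighted_sum c x n + \<rho> *\<^sub>R id_blinfun) o\<^sub>L resolv \<rho> c x n = id_blinfun"
    by (rule blinfun_eqI) (simp add: blinfun.bilinear_simps resolv_right_inverse)
  have 2: "resolv \<rho> c x n o\<^sub>L (weighted_sum c x n + \<rho> *\<^sub>R id_blinfun) = id_blinfun"
  proof (rule blinfun_eqI)
    fix u
    show "blinfun_apply (resolv \<rho> c x n o\<^sub>L (weighted_sum c x n + \<rho> *\<^sub>R id_blinfun)) u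
        = blinfun_apply id_blinfun u"
      using resolv_left_inverse[of x n u] by (simp add: blinfun.add_left blinfun.scaleR_left)
  qed
  show ?thesis unfolding op_inverse_def
  proof (rule the_equality)
    fix B
    assume B: "(weighted_sum c x n + \<rho> *\<^sub>R id_blinfun) o\<^sub>L B = id_blinfun
      \<and> B o\<^sub>L (weighted_sum c x n + \<rho> *\<^sub>R id_blinfun) = id_blinfun"
    show "B = resolv \<rho> c x n"
    proof (rule blinfun_eqI)
      fix u
      have "blinfun_apply B u = blinfun_apply B (blinfun_apply
          ((weighted_sum c x n + \<rho> *\<^sub>R id_blinfun) o\<^sub>L resolv \<rho> c x n) u)" unfolding 1 by simp
      also have "\<dots> = blinfun_apply (B o\<^sub>L (weighted_sum c x n + \<rho> *\<^sub>R id_blinfun))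
          (blinfun_apply (resolv \<rho> c x n) u)" by simp
      finally show "blinfun_apply B u = blinfun_apply (resolv \<rho> c x n) u" using B by simp
    qed
  qed (use 1 2 in blast)
qed

text \<open>Passes from regularization \<rho>, at which the martingale is studied, to regularization
  1, at which determinants of I + A are computed.\<close>

lemma resolv_scale:
  fixes x :: "nat \<Rightarrow> 'a::real_inner"
  shows "resolv 1 (\<lambda>j. c j / \<rho>) x n = \<rho> *\<^sub>R resolv \<rho> c x n"
proof (induction n)
  case 0
  show ?case using \<rho> by simp
next
  case (Suc n)
  define R where "R = resolv \<rho> c x n"
  define z where "z = x (Suc n)"
  have rk: "rank_one (\<rho> *\<^sub>R v) = \<rho>\<^sup>2 *\<^sub>R rank_one v" for v :: 'a
    by (rule blinfun_eqI) (simp add: blinfun.scaleR_left power2_eq_square)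
  have "resolv 1 (\<lambda>j. c j / \<rho>) x (Suc n) = \<rho> *\<^sub>R R -
    ((c (Suc n) / \<rho>) / (1 + c (Suc n) / \<rho> * (z \<bullet> blinfun_apply (\<rho> *\<^sub>R R) z))) *\<^sub>R
      rank_one (blinfun_apply (\<rho> *\<^sub>R R) z)"
    using Suc.IH by (simp add: R_def z_def)
  also have "\<dots> = \<rho> *\<^sub>R R - (\<rho> * (c (Suc n) / (1 + c (Suc n) * (z \<bullet> blinfun_apply R z)))) *\<^sub>R
      rank_one (blinfun_apply R z)"
    using \<rho> by (simp add: blinfun.scaleR_left rk power2_eq_square)
  also have "\<dots> = \<rho> *\<^sub>R resolv \<rho> c x (Suc n)"
    by (simp add: R_def z_def scaleR_diff_right)
  finally show ?case .
qed

end

text \<open>The price of replacing a random level by a nearby deterministic one. With B = A + r I,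
  the number m . v is the maximum over z of 2 m . z - <B z, z>. The test vector z = u / 2 gives m .
  v >= m . u - <B u, u> / 4, and <B u, u> <= 2 m . u because r <= 2 \<rho>.\<close>

lemma resolv_form_compare:
  assumes c: "\<And>j. 0 \<le> c j" and \<rho>: "0 < \<rho>" "\<rho> \<le> r" "r \<le> 2 * \<rho>"
  shows "m \<bullet> blinfun_apply (resolv \<rho> c x n) m \<le> 2 * (m \<bullet> blinfun_apply (resolv r c x n) m)"
proof -
  define A where "A = blinfun_apply (weighted_sum c x n)"
  define u v where "u = blinfun_apply (resolv \<rho> c x n) m" and "v = blinfun_apply (resolv r c x n) m"
  have r: "0 < r" using \<rho> by simp
  have u: "A u + \<rho> *\<^sub>R u = m" unfolding A_def u_def by (rule resolv_right_inverse[OF c \<rho>(1)])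
  have v: "A v + r *\<^sub>R v = m" unfolding A_def v_def by (rule resolv_right_inverse[OF c r])
  have pos: "positive_op (weighted_sum c x n)" by (rule positive_op_weighted_sum[OF c])
  have "positive_op (weighted_sum c x n + r *\<^sub>R id_blinfun)"
    using r by (intro positive_op_add pos positive_op_scaleR positive_op_id) auto
  from positive_op_nonneg[OF this, of "2 *\<^sub>R v - u"]
  have "0 \<le> 2 *\<^sub>R (A v + r *\<^sub>R v) \<bullet> (2 *\<^sub>R v - u) - (A u + r *\<^sub>R u) \<bullet> (2 *\<^sub>R v - u)"
    by (simp add: blinfun.bilinear_simps A_def[symmetric] inner_add_left inner_diff_left algebra_simps)
  also have "(A u + r *\<^sub>R u) \<bullet> (2 *\<^sub>R v - u) = 2 * (u \<bullet> (A v + r *\<^sub>R v)) - (A u + r *\<^sub>R u) \<bullet> u"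
    using positive_op_sym[OF pos, of u v] unfolding A_def[symmetric]
    by (simp add: inner_add_left inner_add_right inner_diff_right)
  finally have 1: "0 \<le> 4 * (m \<bullet> v) - 4 * (m \<bullet> u) + (A u + r *\<^sub>R u) \<bullet> u"
    unfolding v by (simp add: inner_diff_right inner_commute)
  have "(A u + r *\<^sub>R u) \<bullet> u \<le> 2 * ((A u + \<rho> *\<^sub>R u) \<bullet> u)"
    using positive_op_nonneg[OF pos, of u] mult_right_mono[OF \<rho>(3), of "u \<bullet> u"]
    unfolding A_def[symmetric] by (simp add: inner_add_left)
  then have "0 \<le> 4 * (m \<bullet> v) - 2 * (m \<bullet> u)"
    using 1 unfolding u by (simp add: inner_commute)
  then show ?thesis unfolding u_def v_def by simp
qed

section \<open>Square roots of resolvents\<close>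

text \<open>\<open>(I - U)\<^sup>2 = I - T\<close> means \<open>U = (T + U\<^sup>2) / 2\<close>, which has a solution by Banach's fixed point
  theorem. Searching it among the operators commuting with everything that commutes with \<open>T\<close>
  gives uniqueness of the root.\<close>

lemma ex1_positive_sqrt:
  fixes T :: "'a::{real_inner,banach} \<Rightarrow>\<^sub>L 'a"
  assumes sym: "\<And>u v. blinfun_apply T u \<bullet> v = u \<bullet> blinfun_apply T v" and T1: "norm T < 1"
    and k: "0 < k"
  shows "\<exists>!B. positive_op B \<and> B o\<^sub>L B = k *\<^sub>R (id_blinfun - T)"
proof -
  \<comment> \<open>\<open>r\<close> is the smaller root of r = (norm T + r^2) / 2: the ball of
    radius \<open>r\<close> is mapped into itself, and \<open>r\<close> is also the contraction
    factor there.\<close>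
  define s where "s = sqrt (1 - norm T)"
  define r where "r = 1 - s"
  have s: "0 < s" "s \<le> 1" "s\<^sup>2 = 1 - norm T" using T1 unfolding s_def by auto
  then have r: "0 \<le> r" "r < 1" unfolding r_def by auto
  have rr: "(norm T + r\<^sup>2) / 2 = r" unfolding r_def using s(3) by (simp add: power2_diff)
  define S where "S = {U. norm U \<le> r \<and> (\<forall>u v. blinfun_apply U u \<bullet> v = u \<bullet> blinfun_apply U v) \<and>
     (\<forall>C\<in>{C. \<forall>u. blinfun_apply C (blinfun_apply T u) = blinfun_apply T (blinfun_apply C u)}.
       \<forall>u. blinfun_apply C (blinfun_apply U u) = blinfun_apply U (blinfun_apply C u))}"
  define f where "f U = (1/2) *\<^sub>R (T + (U o\<^sub>L U))" for U
  have f_app: "blinfun_apply (f U) u = (1/2) *\<^sub>R (blinfun_apply T u + blinfun_apply U (blinfun_apply U u))"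
    for U u unfolding f_def by (simp add: blinfun.add_left blinfun.scaleR_left)
  have S_norm: "norm U \<le> r" if "U \<in> S" for U using that unfolding S_def by blast
  have S_sym: "blinfun_apply U u \<bullet> v = u \<bullet> blinfun_apply U v" if "U \<in> S" for U u v
    using that unfolding S_def by blast
  have S_comm: "blinfun_apply C (blinfun_apply U u) = blinfun_apply U (blinfun_apply C u)"
    if "U \<in> S" "\<And>u. blinfun_apply C (blinfun_apply T u) = blinfun_apply T (blinfun_apply C u)" for U C u
    using that unfolding S_def by blast
  have "closed S"
  proof -
    let ?K = "{C. \<forall>u. blinfun_apply C (blinfun_apply T u) = blinfun_apply T (blinfun_apply C u)}"
    have "S = {U. norm U \<le> r} \<inter> (\<Inter>u. \<Inter>v. {U. blinfun_apply U u \<bullet> v = u \<bullet> blinfun_apply U v}) \<inter>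
      (\<Inter>C\<in>?K. \<Inter>u. {U. blinfun_apply C (blinfun_apply U u) = blinfun_apply U (blinfun_apply C u)})"
      unfolding S_def by blast
    moreover have "closed {U. norm (U::'a \<Rightarrow>\<^sub>L 'a) \<le> r}"
      by (intro closed_Collect_le continuous_intros)
    moreover have "closed {U. blinfun_apply U u \<bullet> v = u \<bullet> blinfun_apply U v}" for u v :: 'a
      by (intro closed_Collect_eq continuous_intros)
    moreover have "closed {U. blinfun_apply C (blinfun_apply U u) = blinfun_apply U (blinfun_apply C u)}"
      for C :: "'a \<Rightarrow>\<^sub>L 'a" and u
      by (intro closed_Collect_eq continuous_intros)
    ultimately show ?thesis by (simp add: closed_Int closed_INT)
  qed
  then have S1: "Topological_Spaces.complete S" by (simp add: complete_eq_closed)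
  have "0 \<in> S" using r by (simp add: S_def)
  then have S2: "S \<noteq> {}" by blast
  have S3: "f ` S \<subseteq> S"
  proof safe
    fix U assume U: "U \<in> S"
    have "norm (f U) \<le> (norm T + norm U * norm U) / 2"
      unfolding f_def
      using norm_triangle_ineq[of T "U o\<^sub>L U"] norm_blinfun_compose[of U U] by simp
    also have "\<dots> \<le> (norm T + r\<^sup>2) / 2"
      using S_norm[OF U] r unfolding power2_eq_square by (auto intro!: mult_mono)
    finally have "norm (f U) \<le> r" using rr by simp
    moreover have "blinfun_apply (f U) u \<bullet> v = u \<bullet> blinfun_apply (f U) v" for u v
      using S_sym[OF U] sym[of u v] unfolding f_app by (simp add: inner_add_left inner_add_right)
    moreover have "blinfun_apply C (blinfun_apply (f U) u) = blinfun_apply (f U) (blinfun_apply C u)"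
      if "\<forall>u. blinfun_apply C (blinfun_apply T u) = blinfun_apply T (blinfun_apply C u)" for C u
    proof -
      have "blinfun_apply C (blinfun_apply U v) = blinfun_apply U (blinfun_apply C v)" for v
        by (rule S_comm[OF U]) (use that in blast)
      then show ?thesis using that unfolding f_app by (simp add: blinfun.bilinear_simps)
    qed
    ultimately show "f U \<in> S" unfolding S_def by blast
  qed
  have S4: "dist (f U) (f V) \<le> r * dist U V" if U: "U \<in> S" and V: "V \<in> S" for U V
  proof -
    have "f U - f V = (1/2) *\<^sub>R ((U o\<^sub>L (U - V)) + ((U - V) o\<^sub>L V))"
      by (rule blinfun_eqI) (simp add: f_app blinfun.bilinear_simps algebra_simps)
    then have "norm (f U - f V) \<le> (norm U * norm (U - V) + norm (U - V) * norm V) / 2"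
      using norm_triangle_ineq[of "U o\<^sub>L (U - V)" "(U - V) o\<^sub>L V"]
        norm_blinfun_compose[of U "U - V"] norm_blinfun_compose[of "U - V" V] by simp
    also have "\<dots> \<le> (r * norm (U - V) + norm (U - V) * r) / 2"
      using S_norm[OF U] S_norm[OF V] r by (intro divide_right_mono add_mono mult_mono) auto
    finally show ?thesis by (simp add: dist_norm)
  qed
  from Banach_fix[OF S1 S2 r S3 S4] obtain U where U: "U \<in> S" "f U = U" by blast
  have Usym: "blinfun_apply U u \<bullet> v = u \<bullet> blinfun_apply U v" for u v
    by (rule S_sym[OF U(1)])
  have fixU: "2 *\<^sub>R blinfun_apply U u = blinfun_apply T u + blinfun_apply U (blinfun_apply U u)" for u
    using arg_cong[OF U(2), of "\<lambda>W. 2 *\<^sub>R blinfun_apply W u"] unfolding f_app by simp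
  define B where "B = sqrt k *\<^sub>R (id_blinfun - U)"
  have B_app: "blinfun_apply B u = sqrt k *\<^sub>R (u - blinfun_apply U u)" for u
    unfolding B_def by (simp add: blinfun.bilinear_simps)
  \<comment> \<open>Coercivity, stronger than positivity: it will separate \<open>B\<close> from any
    competing root.\<close>
  have Bpos: "sqrt k * (1 - r) * (u \<bullet> u) \<le> blinfun_apply B u \<bullet> u" for u
  proof -
    have "blinfun_apply U u \<bullet> u \<le> norm (blinfun_apply U u) * norm u" by (rule norm_cauchy_schwarz)
    also have "\<dots> \<le> (norm U * norm u) * norm u"
      by (intro mult_right_mono norm_blinfun) auto
    also have "\<dots> \<le> (r * norm u) * norm u"
      using S_norm[OF U(1)] by (intro mult_right_mono) auto
    also have "\<dots> = r * (u \<bullet> u)" by (simp add: dot_square_norm power2_eq_square)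
    finally have "(1 - r) * (u \<bullet> u) \<le> (u - blinfun_apply U u) \<bullet> u"
      by (simp add: inner_diff_left algebra_simps)
    then have "sqrt k * ((1 - r) * (u \<bullet> u)) \<le> sqrt k * ((u - blinfun_apply U u) \<bullet> u)"
      using k by (intro mult_left_mono) auto
    then show ?thesis unfolding B_app by (simp add: mult.assoc)
  qed
  have "positive_op B"
    unfolding positive_op_def
  proof (intro conjI allI)
    show "blinfun_apply B u \<bullet> v = u \<bullet> blinfun_apply B v" for u v
      using Usym[of u v] unfolding B_app by (simp add: inner_diff_left inner_diff_right)
    show "0 \<le> blinfun_apply B u \<bullet> u" for u
      using Bpos[of u] k r by (smt (verit) inner_ge_zero mult_nonneg_nonneg real_sqrt_ge_zero)
  qed
  moreover have BB: "B o\<^sub>L B = k *\<^sub>R (id_blinfun - T)"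
  proof (rule blinfun_eqI)
    fix u
    have "blinfun_apply (B o\<^sub>L B) u = (sqrt k * sqrt k) *\<^sub>R
        (u - 2 *\<^sub>R blinfun_apply U u + blinfun_apply U (blinfun_apply U u))"
      by (simp add: B_app blinfun.bilinear_simps scaleR_2 algebra_simps)
    also have "\<dots> = k *\<^sub>R (u - blinfun_apply T u)" unfolding fixU using k by simp
    finally show "blinfun_apply (B o\<^sub>L B) u = blinfun_apply (k *\<^sub>R (id_blinfun - T)) u"
      by (simp add: blinfun.bilinear_simps)
  qed
  moreover have "C = B" if C: "positive_op C" and CC: "C o\<^sub>L C = k *\<^sub>R (id_blinfun - T)" for C
  proof (rule blinfun_eqI)
    fix u
    have CC': "blinfun_apply C (blinfun_apply C u) = k *\<^sub>R (u - blinfun_apply T u)" for u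
      using arg_cong[OF CC, of "\<lambda>W. blinfun_apply W u"] by (simp add: blinfun.bilinear_simps)
    have T: "blinfun_apply T u = u - (1 / k) *\<^sub>R blinfun_apply C (blinfun_apply C u)" for u
      unfolding CC' using k by simp
    have "blinfun_apply C (blinfun_apply T u) = blinfun_apply T (blinfun_apply C u)" for u
      unfolding T by (simp add: blinfun.bilinear_simps)
    then have CU: "blinfun_apply C (blinfun_apply U u) = blinfun_apply U (blinfun_apply C u)" for u
      by (rule S_comm[OF U(1)])
    have CB: "blinfun_apply C (blinfun_apply B u) = blinfun_apply B (blinfun_apply C u)" for u
      unfolding B_app by (simp add: blinfun.bilinear_simps CU)
    \<comment> \<open>As \<open>B\<close> and \<open>C\<close> commute, (B + C)(B - C) = B^2 - C^2 =
      0; coercivity of \<open>B\<close> and positivity of \<open>C\<close> then force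
      \<open>v = 0\<close>.\<close>
    define v where "v = blinfun_apply B u - blinfun_apply C u"
    have BBu: "blinfun_apply B (blinfun_apply B u) = blinfun_apply C (blinfun_apply C u)"
      using arg_cong[OF BB, of "\<lambda>W. blinfun_apply W u"] unfolding CC'
      by (simp add: blinfun.bilinear_simps)
    have "blinfun_apply B v + blinfun_apply C v = 0"
      unfolding v_def by (simp add: blinfun.bilinear_simps BBu CB)
    then have "blinfun_apply B v \<bullet> v + blinfun_apply C v \<bullet> v = 0"
      by (metis inner_add_left inner_zero_left)
    then have "sqrt k * (1 - r) * (v \<bullet> v) \<le> 0"
      using Bpos[of v] positive_op_nonneg[OF C, of v] by linarith
    moreover have "0 < sqrt k * (1 - r)" using k r by simp
    ultimately have "v \<bullet> v \<le> 0" by (metis mult_pos_pos not_le)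
    then have "v = 0" by (meson inner_gt_zero_iff not_le)
    then show "blinfun_apply C u = blinfun_apply B u" unfolding v_def by simp
  qed
  ultimately show ?thesis by blast
qed

text \<open>R = (I - T) / \<rho> with T = A R, so existence and uniqueness of the root apply as soon
  as the norm of T is strictly below 1; symmetry of the root then gives the quadratic form.\<close>

lemma norm_op_sqrt_resolv:
  fixes x :: "nat \<Rightarrow> 'a::{real_inner,banach}"
  assumes c: "\<And>j. 0 \<le> c j" and \<rho>: "0 < \<rho>"
  shows "(norm (blinfun_apply (op_sqrt (resolv \<rho> c x n)) m))\<^sup>2 = m \<bullet> blinfun_apply (resolv \<rho> c x n) m"
proof -
  define R where "R = resolv \<rho> c x n"
  define A where "A = weighted_sum c x n"
  define T where "T = id_blinfun - \<rho> *\<^sub>R R"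
  have A: "positive_op A" unfolding A_def by (rule positive_op_weighted_sum[OF c])
  have T_app: "blinfun_apply T u = blinfun_apply A (blinfun_apply R u)" for u
    using resolv_right_inverse[of c \<rho> x n u, OF c \<rho>] unfolding T_def R_def A_def
    by (simp add: blinfun.bilinear_simps algebra_simps)
  have sym: "blinfun_apply T u \<bullet> v = u \<bullet> blinfun_apply T v" for u v
    using resolv_sym[of c \<rho> x n u v, OF c \<rho>] unfolding T_def R_def
    by (simp add: blinfun.bilinear_simps inner_diff_left inner_diff_right)
  \<comment> \<open>The 1 keeps \<open>q\<close> positive when A = 0. For u = A y + \<rho> y the
    cross term is nonnegative, so |u|^2 >= |A y|^2 + \<rho>^2 |y|^2 >= (1 + (\<rho> / q)^2) |A y|^2;
    this is the origin of \<open>h\<close>.\<close>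
  define q where "q = norm A + 1"
  have q: "0 < q" "norm A \<le> q" unfolding q_def by (auto simp: add_nonneg_pos)
  define h where "h = 1 / sqrt (1 + (\<rho> / q)\<^sup>2)"
  have pos: "0 < 1 + (\<rho> / q)\<^sup>2" by (simp add: add_pos_nonneg)
  have "norm T \<le> h"
  proof (rule norm_blinfun_bound)
    show "0 \<le> h" unfolding h_def using pos by simp
    fix u
    define y where "y = blinfun_apply R u"
    have u: "u = blinfun_apply A y + \<rho> *\<^sub>R y"
      unfolding y_def A_def R_def by (rule resolv_right_inverse[OF c \<rho>, symmetric])
    have "norm (blinfun_apply A y) \<le> q * norm y"
      using norm_blinfun[of A y] mult_right_mono[OF q(2), of "norm y"] by simp
    then have "\<rho> * norm (blinfun_apply A y) / q \<le> \<rho> * norm y"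
      using q \<rho> by (simp add: field_simps)
    then have "(\<rho> * norm (blinfun_apply A y) / q)\<^sup>2 \<le> (\<rho> * norm y)\<^sup>2"
      using q \<rho> by (intro power_mono) auto
    then have "(1 + (\<rho> / q)\<^sup>2) * (norm (blinfun_apply A y))\<^sup>2
        \<le> (norm (blinfun_apply A y))\<^sup>2 + (\<rho> * norm y)\<^sup>2"
      by (simp add: algebra_simps power_mult_distrib power_divide)
    also have "\<dots> \<le> (norm (blinfun_apply A y))\<^sup>2 + 2 * (\<rho> * (blinfun_apply A y \<bullet> y)) + (\<rho> * norm y)\<^sup>2"
      using positive_op_nonneg[OF A, of y] \<rho> by simp
    also have "\<dots> = (norm u)\<^sup>2"
      unfolding u power2_norm_eq_inner power_mult_distrib
      by (simp add: inner_add_left inner_add_right inner_commute power2_eq_square)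
    finally have "(norm (blinfun_apply A y))\<^sup>2 \<le> (norm u)\<^sup>2 / (1 + (\<rho> / q)\<^sup>2)"
      using pos by (simp add: field_simps)
    also have "\<dots> = (h * norm u)\<^sup>2"
      unfolding h_def using pos by (simp add: power_mult_distrib power_divide)
    finally show "norm (blinfun_apply T u) \<le> h * norm u"
      unfolding T_app y_def using pos by (simp add: h_def power2_le_iff_abs_le)
  qed
  also have "h < 1"
  proof -
    have "0 < (\<rho> / q)\<^sup>2" using \<rho> q by simp
    then have "1 < sqrt (1 + (\<rho> / q)\<^sup>2)" by (subst real_less_rsqrt) auto
    then show ?thesis unfolding h_def by (simp add: field_simps)
  qed
  finally have T1: "norm T < 1" .
  have R: "R = (1 / \<rho>) *\<^sub>R (id_blinfun - T)" unfolding T_def using \<rho> by simp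
  have "\<exists>!B. positive_op B \<and> B o\<^sub>L B = R"
    unfolding R by (rule ex1_positive_sqrt[OF sym T1]) (use \<rho> in simp)
  then have "positive_op (op_sqrt R) \<and> op_sqrt R o\<^sub>L op_sqrt R = R"
    unfolding op_sqrt_def by (rule theI')
  then have "(norm (blinfun_apply (op_sqrt R) m))\<^sup>2 = m \<bullet> blinfun_apply R m"
    by (metis power2_norm_eq_inner positive_op_sym blinfun_apply_blinfun_compose)
  then show ?thesis unfolding R_def .
qed

section \<open>Determinants over finite index sets\<close>

text \<open>Leibniz determinant over an unordered finite index set: the indices will be vectors of
  an orthonormal family.\<close>

definition mdet :: "'i set \<Rightarrow> ('i \<Rightarrow> 'i \<Rightarrow> real) \<Rightarrow> real" where
  "mdet S a = (\<Sum>\<pi> | \<pi> permutes S. of_int (sign \<pi>) * (\<Prod>i\<in>S. a i (\<pi> i)))"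

lemma principal_minor_eq_mdet: "principal_minor A S = mdet S (\<lambda>e f. e \<bullet> blinfun_apply A f)"
  by (simp add: principal_minor_def mdet_def)

lemma mdet_cong:
  assumes "\<And>i j. i \<in> S \<Longrightarrow> j \<in> S \<Longrightarrow> a i j = b i j"
  shows "mdet S a = mdet S b"
  unfolding mdet_def using assms
  by (intro sum.cong refl arg_cong2[of _ _ _ _ "(*)"] prod.cong) (auto simp: permutes_in_image)

text \<open>Conjugating permutations with an enumeration of \<open>S\<close> leads to ordinary
  matrices, from which multiplicativity of the determinant is borrowed.\<close>

lemma mdet_reindex:
  assumes h: "bij_betw h {0..<n} S"
  shows "mdet S a = det (mat n n (\<lambda>(i, j). a (h i) (h j)))"
proof -
  let ?I = "{0..<n}"
  define h' where "h' = inv_into ?I h"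
  have inj: "inj_on h ?I" and im: "h ` ?I = S" using h by (auto simp: bij_betw_def)
  have h': "bij_betw h' S ?I" unfolding h'_def by (rule bij_betw_inv_into[OF h])
  have h'h: "h' (h i) = i" if "i \<in> ?I" for i unfolding h'_def using inj that by simp
  have hh': "h (h' s) = s" if "s \<in> S" for s unfolding h'_def using im that by (simp add: f_inv_into_f)
  have bij: "bij_betw (map_permutation ?I h) {p. p permutes ?I} {p. p permutes S}"
  proof (rule bij_betw_byWitness[where f' = "map_permutation S h'"])
    show "\<forall>p\<in>{p. p permutes ?I}. map_permutation S h' (map_permutation ?I h p) = p"
      using map_permutation_compose_inv[OF h] h'h by blast
    show "\<forall>p\<in>{p. p permutes S}. map_permutation ?I h (map_permutation S h' p) = p"
      using map_permutation_compose_inv[OF h'] hh' by blast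
  qed (use map_permutation_permutes[OF h] map_permutation_permutes[OF h'] in auto)
  have "mdet S a = (\<Sum>p | p permutes ?I. of_int (sign (map_permutation ?I h p)) *
      (\<Prod>i\<in>S. a i (map_permutation ?I h p i)))"
    unfolding mdet_def by (rule sum.reindex_bij_betw[OF bij, symmetric])
  also have "\<dots> = (\<Sum>p | p permutes ?I. of_int (sign p) * (\<Prod>i\<in>?I. a (h i) (h (p i))))"
  proof (intro sum.cong refl arg_cong2[of _ _ _ _ "(*)"])
    fix p assume p: "p \<in> {p. p permutes ?I}"
    show "(of_int (sign (map_permutation ?I h p)) :: real) = of_int (sign p)"
      using p inj by (simp add: sign_map_permutation)
    have "(\<Prod>i\<in>S. a i (map_permutation ?I h p i)) = (\<Prod>i\<in>?I. a (h i) (map_permutation ?I h p (h i)))"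
      by (rule prod.reindex_bij_betw[OF h, symmetric])
    also have "\<dots> = (\<Prod>i\<in>?I. a (h i) (h (p i)))"
      by (intro prod.cong refl) (simp add: map_permutation_apply[OF inj])
    finally show "(\<Prod>i\<in>S. a i (map_permutation ?I h p i)) = (\<Prod>i\<in>?I. a (h i) (h (p i)))" .
  qed
  also have "\<dots> = det (mat n n (\<lambda>(i, j). a (h i) (h j)))"
    unfolding det_def
    by (auto intro!: sum.cong prod.cong simp: permutes_in_image)
  finally show ?thesis .
qed

lemma mdet_mult:
  assumes "finite S"
  shows "mdet S (\<lambda>i j. \<Sum>k\<in>S. a i k * b k j) = mdet S a * mdet S b"
proof -
  obtain h where h: "bij_betw h {0..<card S} S"
    using ex_bij_betw_nat_finite[OF assms] by blast
  let ?M = "\<lambda>a. mat (card S) (card S) (\<lambda>(i, j). a (h i) (h j))"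
  have "?M (\<lambda>i j. \<Sum>k\<in>S. a i k * b k j) = ?M a * ?M b"
    by (rule eq_matI) (auto simp: scalar_prod_def sum.reindex_bij_betw[OF h, symmetric] intro!: sum.cong)
  then show ?thesis
    unfolding mdet_reindex[OF h] by (simp add: det_mult[of _ "card S"])
qed

text \<open>The link between the Fredholm series and ordinary determinants. Expanding the product
  selects the set S of positions at which \<open>a\<close> is used; on T - S the identity entries
  kill every \<pi> that moves a point there, which leaves the permutations of S.\<close>

lemma mdet_delta_add:
  assumes fin: "finite T"
  shows "mdet T (\<lambda>i j. (if i = j then 1 else 0) + a i j) = (\<Sum>S\<in>Pow T. mdet S a)"
proof -
  have "mdet T (\<lambda>i j. (if i = j then 1 else 0) + a i j)
    = (\<Sum>\<pi> | \<pi> permutes T. of_int (sign \<pi>) * (\<Sum>S\<in>Pow T. (\<Prod>i\<in>S. a i (\<pi> i)) *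
        (\<Prod>i\<in>T - S. if i = \<pi> i then 1 else 0)))"
    unfolding mdet_def by (subst prod_add[OF fin, symmetric]) (simp add: add.commute)
  also have "\<dots> = (\<Sum>S\<in>Pow T. \<Sum>\<pi> | \<pi> permutes T. of_int (sign \<pi>) * ((\<Prod>i\<in>S. a i (\<pi> i)) *
        (\<Prod>i\<in>T - S. if i = \<pi> i then 1 else 0)))"
    unfolding sum_distrib_left by (rule sum.swap)
  also have "\<dots> = (\<Sum>S\<in>Pow T. mdet S a)"
  proof (rule sum.cong[OF refl])
    fix S assume S: "S \<in> Pow T"
    have "(\<Sum>\<pi> | \<pi> permutes T. of_int (sign \<pi>) * ((\<Prod>i\<in>S. a i (\<pi> i)) *
        (\<Prod>i\<in>T - S. if i = \<pi> i then 1 else 0)))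
      = (\<Sum>\<pi> | \<pi> permutes S. of_int (sign \<pi>) * ((\<Prod>i\<in>S. a i (\<pi> i)) *
        (\<Prod>i\<in>T - S. if i = \<pi> i then 1 else 0)))"
    proof (rule sum.mono_neutral_right)
      show "finite {\<pi>. \<pi> permutes T}" using fin by (rule finite_permutations)
      show "{\<pi>. \<pi> permutes S} \<subseteq> {\<pi>. \<pi> permutes T}" using S by (auto intro: permutes_subset)
      show "\<forall>\<pi>\<in>{\<pi>. \<pi> permutes T} - {\<pi>. \<pi> permutes S}. of_int (sign \<pi>) * ((\<Prod>i\<in>S. a i (\<pi> i)) *
        (\<Prod>i\<in>T - S. if i = \<pi> i then 1 else 0)) = 0"
      proof
        fix \<pi> assume \<pi>: "\<pi> \<in> {\<pi>. \<pi> permutes T} - {\<pi>. \<pi> permutes S}"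
        have "\<not> (\<forall>i\<in>T - S. \<pi> i = i)" using \<pi> permutes_superset[of \<pi> T S] by auto
        then obtain i where "i \<in> T - S" "i \<noteq> \<pi> i" by metis
        then have "(\<Prod>i\<in>T - S. if i = \<pi> i then 1 else (0::real)) = 0"
          using fin by (intro prod_zero) auto
        then show "of_int (sign \<pi>) * ((\<Prod>i\<in>S. a i (\<pi> i)) *
            (\<Prod>i\<in>T - S. if i = \<pi> i then 1 else 0)) = 0" by simp
      qed
    qed
    also have "\<dots> = mdet S a"
      unfolding mdet_def
    proof (rule sum.cong[OF refl])
      fix \<pi> assume "\<pi> \<in> {\<pi>. \<pi> permutes S}"
      then have "i = \<pi> i" if "i \<notin> S" for i using that permutes_not_in by fastforce
      then have "(\<Prod>i\<in>T - S. if i = \<pi> i then 1 else (0::real)) = 1" by (intro prod.neutral) auto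
      then show "of_int (sign \<pi>) * ((\<Prod>i\<in>S. a i (\<pi> i)) *
            (\<Prod>i\<in>T - S. if i = \<pi> i then 1 else 0)) = of_int (sign \<pi>) * (\<Prod>i\<in>S. a i (\<pi> i))"
        by simp
    qed
    finally show "(\<Sum>\<pi> | \<pi> permutes T. of_int (sign \<pi>) * ((\<Prod>i\<in>S. a i (\<pi> i)) *
        (\<Prod>i\<in>T - S. if i = \<pi> i then 1 else 0))) = mdet S a" .
  qed
  finally show ?thesis .
qed

text \<open>Composition with the transposition of \<open>a\<close> and \<open>b\<close> is a
  sign-reversing bijection of the permutations.\<close>

lemma sum_sign_permutes_eq_0:
  assumes fin: "finite S" and ab: "a \<in> S" "b \<in> S" "a \<noteq> b"
  shows "(\<Sum>\<pi> | \<pi> permutes S. real_of_int (sign \<pi>)) = 0"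
proof -
  let ?t = "Transposition.transpose a b"
  have t: "?t permutes S" using ab(1,2) by (rule permutes_swap_id)
  have "bij_betw (\<lambda>\<pi>. \<pi> \<circ> ?t) {\<pi>. \<pi> permutes S} {\<pi>. \<pi> permutes S}"
    by (rule bij_betw_byWitness[where f' = "\<lambda>\<pi>. \<pi> \<circ> ?t"])
      (auto simp: o_assoc[symmetric] intro: permutes_compose[OF t])
  then have "(\<Sum>\<pi> | \<pi> permutes S. real_of_int (sign \<pi>)) = (\<Sum>\<pi> | \<pi> permutes S. real_of_int (sign (\<pi> \<circ> ?t)))"
    by (rule sum.reindex_bij_betw[symmetric])
  also have "\<dots> = (\<Sum>\<pi> | \<pi> permutes S. - real_of_int (sign \<pi>))"
  proof (rule sum.cong[OF refl])
    fix \<pi> assume "\<pi> \<in> {\<pi>. \<pi> permutes S}"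
    then have "permutation \<pi>" using fin by (auto intro: permutes_imp_permutation)
    then have "sign (\<pi> \<circ> ?t) = sign \<pi> * sign ?t"
      by (rule sign_compose) (rule permutation_swap_id)
    then show "real_of_int (sign (\<pi> \<circ> ?t)) = - real_of_int (sign \<pi>)"
      using ab by (simp add: sign_swap_id)
  qed
  finally show ?thesis by (simp add: sum_negf)
qed

text \<open>In a minor of a rank-one matrix every permutation contributes the same product up to
  sign, so minors of size at least 2 vanish; the empty minor gives 1 and the singletons give the
  sum.\<close>

lemma mdet_delta_add_rank_one:
  assumes fin: "finite T"
  shows "mdet T (\<lambda>i j. (if i = j then 1 else 0) + v i * u j) = 1 + (\<Sum>i\<in>T. v i * u i)"
proof -
  have minors: "mdet S (\<lambda>i j. v i * u j) = 0" if S: "S \<in> Pow T - insert {} ((\<lambda>i. {i}) ` T)" for S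
  proof -
    have finS: "finite S" using S fin finite_subset by blast
    obtain a where a: "a \<in> S" using S by blast
    have "S \<noteq> {a}" using S a by blast
    then obtain b where b: "b \<in> S" "a \<noteq> b" using a by blast
    have "mdet S (\<lambda>i j. v i * u j) = (\<Sum>\<pi> | \<pi> permutes S. real_of_int (sign \<pi>) * ((\<Prod>i\<in>S. v i) * (\<Prod>i\<in>S. u i)))"
      unfolding mdet_def
    proof (rule sum.cong[OF refl])
      fix \<pi> assume "\<pi> \<in> {\<pi>. \<pi> permutes S}"
      then have "bij_betw \<pi> S S" by (simp add: permutes_imp_bij)
      then have "(\<Prod>i\<in>S. u (\<pi> i)) = (\<Prod>i\<in>S. u i)" by (rule prod.reindex_bij_betw)
      then show "of_int (sign \<pi>) * (\<Prod>i\<in>S. v i * u (\<pi> i)) =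
          real_of_int (sign \<pi>) * ((\<Prod>i\<in>S. v i) * (\<Prod>i\<in>S. u i))"
        by (simp add: prod.distrib)
    qed
    then show ?thesis
      using sum_sign_permutes_eq_0[OF finS a b] by (simp add: sum_distrib_right[symmetric])
  qed
  have "mdet T (\<lambda>i j. (if i = j then 1 else 0) + v i * u j) = (\<Sum>S\<in>Pow T. mdet S (\<lambda>i j. v i * u j))"
    by (rule mdet_delta_add[OF fin])
  also have "\<dots> = (\<Sum>S\<in>insert {} ((\<lambda>i. {i}) ` T). mdet S (\<lambda>i j. v i * u j))"
    using fin minors by (intro sum.mono_neutral_right) auto
  also have "\<dots> = mdet {} (\<lambda>i j. v i * u j) + (\<Sum>S\<in>(\<lambda>i. {i}) ` T. mdet S (\<lambda>i j. v i * u j))"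
    using fin by (intro sum.insert) auto
  also have "(\<Sum>S\<in>(\<lambda>i. {i}) ` T. mdet S (\<lambda>i j. v i * u j)) = (\<Sum>i\<in>T. mdet {i} (\<lambda>i j. v i * u j))"
    by (subst sum.reindex) (auto simp: inj_on_def)
  also have "mdet {} (\<lambda>i j. v i * u j) = 1"
    by (simp add: mdet_def)
  also have "(\<Sum>i\<in>T. mdet {i} (\<lambda>i j. v i * u j)) = (\<Sum>i\<in>T. v i * u i)"
    by (simp add: mdet_def)
  finally show ?thesis .
qed

text \<open>Matrix determinant lemma by factoring: if a v = y, then a + y u^T = a (I + v
  u^T).\<close>

lemma mdet_add_rank_one:
  assumes fin: "finite T" and v: "\<And>i. i \<in> T \<Longrightarrow> (\<Sum>k\<in>T. a i k * v k) = y i"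
  shows "mdet T (\<lambda>i j. a i j + y i * u j) = mdet T a * (1 + (\<Sum>i\<in>T. v i * u i))"
proof -
  have "mdet T (\<lambda>i j. a i j + y i * u j)
      = mdet T (\<lambda>i j. \<Sum>k\<in>T. a i k * ((if k = j then 1 else 0) + v k * u j))"
  proof (rule mdet_cong)
    fix i j assume i: "i \<in> T" and j: "j \<in> T"
    have "(\<Sum>k\<in>T. a i k * ((if k = j then 1 else 0) + v k * u j))
        = (\<Sum>k\<in>T. a i k * (if k = j then 1 else 0)) + (\<Sum>k\<in>T. a i k * v k) * u j"
      by (simp add: distrib_left sum.distrib sum_distrib_right mult.assoc)
    also have "(\<Sum>k\<in>T. a i k * (if k = j then 1 else 0)) = a i j"
      using fin j by (simp add: if_distrib cong: if_cong)
    finally show "a i j + y i * u j = (\<Sum>k\<in>T. a i k * ((if k = j then 1 else 0) + v k * u j))"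
      using v[OF i] by simp
  qed
  then show ?thesis
    by (simp only: mdet_mult[OF fin] mdet_delta_add_rank_one[OF fin])
qed

section \<open>Fredholm determinants of finite rank operators\<close>

text \<open>\<open>fredholm_det\<close> picks its basis with \<open>SOME\<close>, so nothing is
  known about it until one exists. Gram-Schmidt along a countable dense sequence yields increasing
  finite orthonormal sets, whose union has dense span.\<close>

lemma orthonormal_basis_exists:
  "\<exists>E::'a::{real_inner,second_countable_topology} set. orthonormal_basis E"
proof -
  obtain D :: "'a set" where D: "countable D" "\<And>X. open X \<Longrightarrow> X \<noteq> {} \<Longrightarrow> \<exists>d\<in>D. d \<in> X"
    using countable_dense_exists[where 'a = 'a] by blast
  define d where "d = from_nat_into D"
  have "D \<noteq> {}" using D(2)[of UNIV] by auto
  then have ran_d: "range d = D" unfolding d_def using D(1) by (rule range_from_nat_into)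
  define on where "on B \<longleftrightarrow> finite B \<and> pairwise orthogonal B \<and> (\<forall>e\<in>B. norm e = 1)" for B :: "'a set"
  have step: "\<exists>B'. on B' \<and> (B \<subseteq> B' \<and> x \<in> span B')" if B: "on B" for B x
  proof (cases "x \<in> span B")
    case False
    define v where "v = x - (\<Sum>b\<in>B. (x \<bullet> b) *\<^sub>R b)"
    have p: "(\<Sum>b\<in>B. (x \<bullet> b) *\<^sub>R b) \<in> span B"
      by (intro span_sum span_scale span_base)
    have v0: "v \<noteq> 0" using False p unfolding v_def by auto
    have v_orth: "v \<bullet> b = 0" if b: "b \<in> B" for b
    proof -
      have "(\<Sum>b'\<in>B. (x \<bullet> b') *\<^sub>R b') \<bullet> b = (\<Sum>b'\<in>B. (x \<bullet> b') * (b' \<bullet> b))"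
        by (simp add: inner_sum_left)
      also have "\<dots> = (\<Sum>b'\<in>B. if b' = b then x \<bullet> b else 0)"
        using B b by (intro sum.cong refl)
          (auto simp: on_def pairwise_def orthogonal_def dot_square_norm)
      also have "\<dots> = x \<bullet> b" using B b by (simp add: on_def)
      finally show ?thesis unfolding v_def by (simp add: inner_diff_left)
    qed
    define e where "e = (1 / norm v) *\<^sub>R v"
    have "on (insert e B)"
      using B v_orth v0 unfolding on_def e_def
      by (auto simp: pairwise_insert orthogonal_def inner_commute)
    moreover have "x \<in> span (insert e B)"
    proof -
      have "v = norm v *\<^sub>R e" unfolding e_def using v0 by simp
      then have "v \<in> span (insert e B)" by (metis span_scale span_base insertI1)
      moreover have "(\<Sum>b\<in>B. (x \<bullet> b) *\<^sub>R b) \<in> span (insert e B)"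
        using p span_mono[of B "insert e B"] by blast
      ultimately have "v + (\<Sum>b\<in>B. (x \<bullet> b) *\<^sub>R b) \<in> span (insert e B)" by (rule span_add)
      then show ?thesis unfolding v_def by simp
    qed
    ultimately show ?thesis by blast
  qed (use that in blast)
  have "\<exists>f. \<forall>n. on (f n) \<and> (f n \<subseteq> f (Suc n) \<and> d n \<in> span (f (Suc n)))"
    by (rule dependent_nat_choice) (use step in \<open>auto simp: on_def intro: exI[of _ "{}"]\<close>)
  then obtain f where f: "\<And>n. on (f n)" "\<And>n. f n \<subseteq> f (Suc n)" "\<And>n. d n \<in> span (f (Suc n))"
    by blast
  have mono: "m \<le> n \<Longrightarrow> f m \<subseteq> f n" for m n
    by (rule lift_Suc_mono_le[of f]) (use f in auto)
  define E where "E = (\<Union>n. f n)"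
  have "pairwise orthogonal E"
  proof (rule pairwiseI)
    fix a b assume "a \<in> E" "b \<in> E" and ab: "a \<noteq> b"
    then obtain m n where "a \<in> f m" "b \<in> f n" unfolding E_def by blast
    then have "a \<in> f (max m n)" "b \<in> f (max m n)"
      using mono[of m "max m n"] mono[of n "max m n"] by auto
    then show "orthogonal a b" using f(1)[of "max m n"] ab unfolding on_def pairwise_def by blast
  qed
  moreover have "\<forall>e\<in>E. norm e = 1" using f(1) unfolding E_def on_def by blast
  moreover have "closure (span E) = UNIV"
  proof (rule ccontr)
    assume "closure (span E) \<noteq> UNIV"
    then have "- closure (span E) \<noteq> {}" by blast
    then obtain y where y: "y \<in> D" "y \<in> - closure (span E)"
      using D(2)[of "- closure (span E)"] by auto
    obtain n where "y = d n" using y(1) ran_d by blast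
    then have "y \<in> span (f (Suc n))" using f(3) by simp
    then have "y \<in> span E" using span_mono[of "f (Suc n)" E] unfolding E_def by blast
    then show False using y(2) closure_subset by blast
  qed
  ultimately show ?thesis unfolding orthonormal_basis_def by blast
qed

definition orth_proj :: "'a set \<Rightarrow> 'a::real_inner \<Rightarrow> 'a" where
  "orth_proj T u = (\<Sum>e\<in>T. (u \<bullet> e) *\<^sub>R e)"

context
  fixes T :: "'a::real_inner set"
  assumes fin: "finite T" and orth: "pairwise orthogonal T" and unit: "\<forall>e\<in>T. norm e = 1"
begin

lemma inner_orthonormal: "e \<in> T \<Longrightarrow> f \<in> T \<Longrightarrow> e \<bullet> f = (if e = f then 1 else 0)"
  using orth unit by (auto simp: pairwise_def orthogonal_def dot_square_norm)

lemma inner_orth_proj: "e \<in> T \<Longrightarrow> e \<bullet> orth_proj T u = e \<bullet> u"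
  unfolding orth_proj_def inner_sum_right
  using fin by (simp add: inner_orthonormal if_distrib inner_commute cong: if_cong)

lemma orth_proj_idem: "orth_proj T (orth_proj T u) = orth_proj T u"
  unfolding orth_proj_def[of T "orth_proj T u"] orth_proj_def[of T u, symmetric]
  by (subst orth_proj_def) (auto intro!: sum.cong simp: inner_orth_proj inner_commute)

text \<open>This makes projections converge along growing \<open>T\<close>: an approximant in the
  span of some finite set stays available in all larger ones. The proof is Pythagoras.\<close>

lemma orth_proj_best_approx:
  assumes "v \<in> span T"
  shows "norm (x - orth_proj T x) \<le> norm (x - v)"
proof -
  have p: "orth_proj T x \<in> span T" unfolding orth_proj_def by (intro span_sum span_scale span_base)
  define w where "w = orth_proj T x - v"
  have w: "w \<in> span T" unfolding w_def using p assms by (rule span_diff)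
  have "orthogonal (x - orth_proj T x) w"
    by (rule orthogonal_to_span[OF w])
      (simp add: orthogonal_def inner_commute[of "x - _"] inner_diff_right inner_orth_proj)
  then have "(norm ((x - orth_proj T x) + w))\<^sup>2 = (norm (x - orth_proj T x))\<^sup>2 + (norm w)\<^sup>2"
    by (rule norm_add_Pythagorean)
  then have "(norm (x - orth_proj T x))\<^sup>2 \<le> (norm (x - v))\<^sup>2" unfolding w_def by simp
  then show ?thesis by (simp add: power2_le_iff_abs_le)
qed

end

text \<open>The determinant of I + A for A = \<open>weighted_sum c x n\<close>, by iterating the
  matrix determinant lemma. Factor \<open>j\<close> uses the resolvent before vector
  \<open>j\<close> is added, hence \<open>j - 1\<close>. Unlike the Fredholm series it refers to no
  basis.\<close>

definition det_prod :: "(nat \<Rightarrow> real) \<Rightarrow> (nat \<Rightarrow> 'a::real_inner) \<Rightarrow> nat \<Rightarrow> real" where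
  "det_prod c x n = (\<Prod>j=1..n. 1 + c j * (x j \<bullet> blinfun_apply (resolv 1 c x (j - 1)) (x j)))"

lemma det_prod_0 [simp]: "det_prod c x 0 = 1"
  by (simp add: det_prod_def)

lemma det_prod_Suc:
  "det_prod c x (Suc n) = det_prod c x n *
     (1 + c (Suc n) * (x (Suc n) \<bullet> blinfun_apply (resolv 1 c x n) (x (Suc n))))"
  by (simp add: det_prod_def)

lemma det_prod_pos:
  assumes "\<And>j. 0 \<le> c j"
  shows "0 < det_prod c x n"
  unfolding det_prod_def
  by (intro prod_pos add_pos_nonneg mult_nonneg_nonneg assms resolv_form_nonneg) auto

lemma inner_weighted_sum:
  "e \<bullet> blinfun_apply (weighted_sum c x n) f = (\<Sum>j=1..n. c j * ((e \<bullet> x j) * (x j \<bullet> f)))"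
  unfolding weighted_sum_def
  by (simp add: blinfun.sum_left blinfun.scaleR_left inner_sum_right mult.commute mult.left_commute)

text \<open>On \<open>T\<close> the matrix of A sees only the projected vectors, so each new vector
  is a rank-one update. The resolvent of the projected vectors solves the linear system required by
  \<open>mdet_add_rank_one\<close>.\<close>

lemma mdet_weighted_sum:
  fixes x :: "nat \<Rightarrow> 'a::real_inner"
  assumes c: "\<And>j. 0 \<le> c j"
    and fin: "finite T" and orth: "pairwise orthogonal T" and unit: "\<forall>e\<in>T. norm e = 1"
  shows "mdet T (\<lambda>e f. (if e = f then 1 else 0) + e \<bullet> blinfun_apply (weighted_sum c x n) f)
    = det_prod c (\<lambda>j. orth_proj T (x j)) n"
proof (induction n)
  case 0
  show ?case using mdet_delta_add_rank_one[OF fin, of "\<lambda>_. 0"] by simp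
next
  case (Suc n)
  define z where "z j = orth_proj T (x j)" for j
  define k where "k = c (Suc n)"
  define B where "B e f = (if e = f then 1 else 0) + e \<bullet> blinfun_apply (weighted_sum c x n) f" for e f
  define v where "v = k *\<^sub>R blinfun_apply (resolv 1 c z n) (z (Suc n))"
  note proj = inner_orth_proj[OF fin orth unit]
  have proj': "orth_proj T u \<bullet> e = u \<bullet> e" if "e \<in> T" for u e
    using proj[OF that, of u] by (simp add: inner_commute)
  have Az: "e \<bullet> blinfun_apply (weighted_sum c x m) f = e \<bullet> blinfun_apply (weighted_sum c z m) f"
    if "e \<in> T" "f \<in> T" for e f m
    unfolding inner_weighted_sum z_def using that by (simp add: proj proj')
  have v_eq: "blinfun_apply (weighted_sum c z n) v + v = k *\<^sub>R z (Suc n)"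
    using arg_cong[OF resolv_right_inverse[of c 1 z n "z (Suc n)", OF c], of "\<lambda>u. k *\<^sub>R u"]
    unfolding v_def by (simp add: blinfun.scaleR_right scaleR_add_right)
  have lin: "orth_proj T (a - b) = orth_proj T a - orth_proj T b"
    "orth_proj T (s *\<^sub>R a) = s *\<^sub>R orth_proj T a" for a b s
    unfolding orth_proj_def
    by (simp_all add: inner_diff_left scaleR_diff_left sum_subtractf scaleR_sum_right)
  have lin_sum: "orth_proj T (\<Sum>j=1..m. g j) = (\<Sum>j=1..m. orth_proj T (g j))" for m and g :: "nat \<Rightarrow> 'a"
    unfolding orth_proj_def inner_sum_left scaleR_sum_left by (rule sum.swap)
  have z_idem: "orth_proj T (z j) = z j" for j
    unfolding z_def by (rule orth_proj_idem[OF fin orth unit])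
  have "blinfun_apply (weighted_sum c z n) v = (\<Sum>j=1..n. (c j * (z j \<bullet> v)) *\<^sub>R z j)"
    unfolding weighted_sum_def by (simp add: blinfun.sum_left blinfun.scaleR_left)
  \<comment> \<open>Solved for \<open>v\<close>, the equation exhibits it as a combination of
    projected vectors; so \<open>v\<close> lies in the span of \<open>T\<close> and equals its
    expansion there.\<close>
  then have v_eq': "v = k *\<^sub>R z (Suc n) - (\<Sum>j=1..n. (c j * (z j \<bullet> v)) *\<^sub>R z j)"
    using v_eq by (simp add: algebra_simps)
  have "orth_proj T v = orth_proj T (k *\<^sub>R z (Suc n) - (\<Sum>j=1..n. (c j * (z j \<bullet> v)) *\<^sub>R z j))"
    using v_eq' by (rule arg_cong)
  also have "\<dots> = k *\<^sub>R z (Suc n) - (\<Sum>j=1..n. (c j * (z j \<bullet> v)) *\<^sub>R z j)"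
    by (simp only: lin lin_sum z_idem)
  finally have v_proj: "orth_proj T v = v" using v_eq' by simp
  then have v_exp: "v = (\<Sum>e\<in>T. (e \<bullet> v) *\<^sub>R e)"
    unfolding orth_proj_def by (simp add: inner_commute)
  have "(\<Sum>f\<in>T. B e f * (f \<bullet> v)) = k * (e \<bullet> z (Suc n))" if e: "e \<in> T" for e
  proof -
    have "(\<Sum>f\<in>T. B e f * (f \<bullet> v)) = (\<Sum>f\<in>T. (if e = f then 1 else 0) * (f \<bullet> v))
        + (\<Sum>f\<in>T. (e \<bullet> blinfun_apply (weighted_sum c z n) f) * (f \<bullet> v))"
      unfolding B_def using e by (simp add: distrib_right sum.distrib Az)
    also have "(\<Sum>f\<in>T. (if e = f then 1 else 0) * (f \<bullet> v)) = e \<bullet> v"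
      using fin e by (simp add: if_distrib[of "\<lambda>a. a * _"] cong: if_cong)
    also have "(\<Sum>f\<in>T. (e \<bullet> blinfun_apply (weighted_sum c z n) f) * (f \<bullet> v))
        = e \<bullet> blinfun_apply (weighted_sum c z n) (\<Sum>f\<in>T. (f \<bullet> v) *\<^sub>R f)"
      by (simp add: blinfun.sum_right blinfun.scaleR_right inner_sum_right mult.commute)
    also have "\<dots> = e \<bullet> blinfun_apply (weighted_sum c z n) v" by (simp only: v_exp[symmetric])
    also have "e \<bullet> v + \<dots> = e \<bullet> (k *\<^sub>R z (Suc n))" unfolding v_eq[symmetric] by (simp add: inner_add_right)
    finally show ?thesis by simp
  qed
  from mdet_add_rank_one[OF fin this, where u = "\<lambda>f. z (Suc n) \<bullet> f"]
  have "mdet T (\<lambda>e f. B e f + k * (e \<bullet> z (Suc n)) * (z (Suc n) \<bullet> f))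
      = mdet T B * (1 + (\<Sum>e\<in>T. (e \<bullet> v) * (z (Suc n) \<bullet> e)))" by simp
  also have "(\<Sum>e\<in>T. (e \<bullet> v) * (z (Suc n) \<bullet> e)) = z (Suc n) \<bullet> (\<Sum>e\<in>T. (e \<bullet> v) *\<^sub>R e)"
    by (simp add: inner_sum_right)
  also have "\<dots> = k * (z (Suc n) \<bullet> blinfun_apply (resolv 1 c z n) (z (Suc n)))"
    unfolding v_exp[symmetric] by (simp add: v_def)
  also have "mdet T B = det_prod c z n"
    using Suc.IH unfolding B_def z_def .
  also have "mdet T (\<lambda>e f. B e f + k * (e \<bullet> z (Suc n)) * (z (Suc n) \<bullet> f))
    = mdet T (\<lambda>e f. (if e = f then 1 else 0) + e \<bullet> blinfun_apply (weighted_sum c x (Suc n)) f)"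
    by (rule mdet_cong)
      (simp add: B_def weighted_sum_Suc blinfun.add_left blinfun.scaleR_left inner_add_right k_def
        z_def proj proj' mult.commute mult.left_commute)
  finally show ?case unfolding det_prod_Suc k_def z_def .
qed

lemma sum_principal_minor_weighted_sum:
  assumes "\<And>j. 0 \<le> c j" "finite T" "pairwise orthogonal T" "\<forall>e\<in>T. norm e = 1"
  shows "(\<Sum>S\<in>Pow T. principal_minor (weighted_sum c x n) S) = det_prod c (\<lambda>j. orth_proj T (x j)) n"
  using mdet_weighted_sum[where c = c and x = x and n = n, OF assms] mdet_delta_add[OF assms(2)]
  by (simp add: principal_minor_eq_mdet)

text \<open>The minors of \<open>\<delta> I + A\<close> are positive by the product formula for \<open>I + A / \<delta>\<close>; let \<open>\<delta>\<close> tend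
  to \<open>0\<close>.\<close>

lemma principal_minor_weighted_sum_nonneg:
  assumes c: "\<And>j. 0 \<le> c j" and T: "finite T" "pairwise orthogonal T" "\<forall>e\<in>T. norm e = 1"
  shows "0 \<le> principal_minor (weighted_sum c x n) T"
proof -
  let ?a = "\<lambda>e f. e \<bullet> blinfun_apply (weighted_sum c x n) f"
  let ?m = "\<lambda>\<delta>. mdet T (\<lambda>e f. \<delta> * (if e = f then 1 else 0) + ?a e f)"
  have pos: "0 \<le> ?m \<delta>" if \<delta>: "0 < \<delta>" for \<delta> :: real
  proof -
    have eq: "\<delta> * (if e = f then 1 else 0) + ?a e f = \<delta> * ((if e = f then 1 else 0) +
        e \<bullet> blinfun_apply (weighted_sum (\<lambda>j. c j / \<delta>) x n) f)" for e f
      using \<delta> unfolding inner_weighted_sum by (simp add: distrib_left sum_distrib_left)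
    have "?m \<delta> = \<delta> ^ card T * mdet T (\<lambda>e f. (if e = f then 1 else 0) +
        e \<bullet> blinfun_apply (weighted_sum (\<lambda>j. c j / \<delta>) x n) f)"
      unfolding eq mdet_def prod.distrib prod_constant
      by (simp add: sum_distrib_left mult.left_commute)
    also have "\<dots> = \<delta> ^ card T * det_prod (\<lambda>j. c j / \<delta>) (\<lambda>j. orth_proj T (x j)) n"
      using c \<delta> by (subst mdet_weighted_sum[OF _ T]) auto
    finally show ?thesis
      using \<delta> det_prod_pos[of "\<lambda>j. c j / \<delta>" "\<lambda>j. orth_proj T (x j)" n] c by simp
  qed
  have "((\<lambda>\<delta>. ?m \<delta>) \<longlongrightarrow> mdet T (\<lambda>e f. 0 * (if e = f then 1 else 0) + ?a e f)) (at_right 0)"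
    unfolding mdet_def by (intro tendsto_intros)
  moreover have "eventually (\<lambda>\<delta>. 0 \<le> ?m \<delta>) (at_right 0)"
    using pos by (auto simp: eventually_at_right_less intro: eventually_mono[OF eventually_at_right_less])
  ultimately have "0 \<le> mdet T (\<lambda>e f. 0 * (if e = f then 1 else 0) + ?a e f)"
    by (rule tendsto_lowerbound) simp
  then show ?thesis by (simp add: principal_minor_eq_mdet)
qed

text \<open>Continuity by the recursion, whose denominators are at least 1. The argument
  \<open>u\<close> must be allowed to move, since the recursion applies the previous resolvent to
  the moving vector itself.\<close>

lemma tendsto_resolv:
  fixes x :: "'b \<Rightarrow> nat \<Rightarrow> 'a::real_inner"
  assumes c: "\<And>j. 0 \<le> c j" and \<rho>: "0 < \<rho>" and x: "\<And>j. ((\<lambda>t. x t j) \<longlongrightarrow> z j) F"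
    and u: "(u \<longlongrightarrow> w) F"
  shows "((\<lambda>t. blinfun_apply (resolv \<rho> c (x t) n) (u t)) \<longlongrightarrow> blinfun_apply (resolv \<rho> c z n) w) F"
  using u
proof (induction n arbitrary: u w)
  case 0
  then show ?case by (auto simp: blinfun.scaleR_left intro!: tendsto_intros)
next
  case (Suc n)
  have "1 + c (Suc n) * (z (Suc n) \<bullet> blinfun_apply (resolv \<rho> c z n) (z (Suc n))) \<noteq> 0"
    using c[of "Suc n"] resolv_form_nonneg[of c \<rho> "z (Suc n)" z n, OF c \<rho>]
    by (smt (verit) mult_nonneg_nonneg)
  then show ?case
    by (simp add: blinfun.bilinear_simps)
      (intro tendsto_intros Suc.IH x Suc.prems; simp)
qed

text \<open>Over the subsets of a finite T the minors add up to \<open>det_prod\<close> of the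
  projected vectors, which tends to \<open>det_prod c x n\<close> as T grows. A finite family of
  subsets that is no power set is squeezed between two power sets, because minors are
  nonnegative.\<close>

theorem fredholm_det_weighted_sum:
  fixes x :: "nat \<Rightarrow> 'a::{real_inner,second_countable_topology}"
  assumes c: "\<And>j. 0 \<le> c j"
  shows "fredholm_det (weighted_sum c x n) = det_prod c x n"
proof -
  define E :: "'a set" where "E = (SOME E. orthonormal_basis E)"
  have E: "orthonormal_basis E"
    unfolding E_def using orthonormal_basis_exists by (rule someI_ex)
  define g where "g = principal_minor (weighted_sum c x n)"
  define p where "p T = det_prod c (\<lambda>j. orth_proj T (x j)) n" for T
  let ?P = "{S. finite S \<and> S \<subseteq> E}"
  have on: "pairwise orthogonal T" "\<forall>e\<in>T. norm e = 1" if "T \<subseteq> E" for T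
    using E that unfolding orthonormal_basis_def by (auto intro: pairwise_subset)
  have proj: "((\<lambda>T. orth_proj T u) \<longlongrightarrow> u) (finite_subsets_at_top E)" for u
  proof (rule tendstoI)
    fix e :: real assume e: "0 < e"
    have "u \<in> closure (span E)" using E unfolding orthonormal_basis_def by simp
    then obtain v where v: "v \<in> span E" "dist v u < e" using e by (meson closure_approachable)
    from v(1) obtain T0 s where T0: "finite T0" "T0 \<subseteq> E" and "v = (\<Sum>a\<in>T0. s a *\<^sub>R a)"
      unfolding span_explicit by blast
    then have v_T0: "v \<in> span T0" by (auto intro: span_sum span_scale span_base)
    show "eventually (\<lambda>T. dist (orth_proj T u) u < e) (finite_subsets_at_top E)"
      unfolding eventually_finite_subsets_at_top
    proof (intro exI[of _ T0] conjI allI impI)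
      fix T assume T: "finite T \<and> T0 \<subseteq> T \<and> T \<subseteq> E"
      then have "v \<in> span T" using v_T0 span_mono[of T0 T] by blast
      then have "norm (u - orth_proj T u) \<le> norm (u - v)"
        using orth_proj_best_approx[of T v u] T on by blast
      then show "dist (orth_proj T u) u < e" using v(2) by (simp add: dist_norm norm_minus_commute)
    qed (use T0 in auto)
  qed
  have p_lim: "(p \<longlongrightarrow> det_prod c x n) (finite_subsets_at_top E)"
    unfolding p_def det_prod_def
    by (intro tendsto_intros tendsto_resolv proj c) simp
  have nonneg: "0 \<le> g S" if "S \<in> ?P" for S
    unfolding g_def using that on by (intro principal_minor_weighted_sum_nonneg c) auto
  have p: "(\<Sum>S\<in>Pow T. g S) = p T" if "finite T" "T \<subseteq> E" for T
    unfolding g_def p_def using that on by (intro sum_principal_minor_weighted_sum c) auto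
  have "(g has_sum det_prod c x n) ?P"
    unfolding has_sum_def
  proof (rule tendstoI)
    fix e :: real assume "0 < e"
    with p_lim have "eventually (\<lambda>T. dist (p T) (det_prod c x n) < e) (finite_subsets_at_top E)"
      by (rule tendstoD)
    then obtain T0 where T0: "finite T0" "T0 \<subseteq> E"
      and T0_lim: "\<And>T. finite T \<Longrightarrow> T0 \<subseteq> T \<Longrightarrow> T \<subseteq> E \<Longrightarrow> dist (p T) (det_prod c x n) < e"
      unfolding eventually_finite_subsets_at_top by auto
    show "eventually (\<lambda>Q. dist (sum g Q) (det_prod c x n) < e) (finite_subsets_at_top ?P)"
      unfolding eventually_finite_subsets_at_top
    proof (intro exI[of _ "Pow T0"] conjI allI impI)
      show "finite (Pow T0)" using T0 by simp
      show "Pow T0 \<subseteq> ?P" using T0 by (auto intro: finite_subset)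
      fix Q assume Q: "finite Q \<and> Pow T0 \<subseteq> Q \<and> Q \<subseteq> ?P"
      \<comment> \<open>Chosen so that \<open>Q\<close> lies between \<open>Pow T0\<close> and
        \<open>Pow T\<close>, whose sums are both close to the limit.\<close>
      define T where "T = T0 \<union> \<Union>Q"
      have T: "finite T" "T \<subseteq> E" "T0 \<subseteq> T" using Q T0 unfolding T_def by auto
      have QT: "Q \<subseteq> Pow T" unfolding T_def by blast
      have PT: "Pow T \<subseteq> ?P" using T by (auto intro: finite_subset)
      have "p T0 \<le> sum g Q"
        unfolding p[OF T0, symmetric] using Q nonneg by (intro sum_mono2) auto
      moreover have "sum g Q \<le> p T"
        unfolding p[OF T(1,2), symmetric] using QT PT nonneg T by (intro sum_mono2) auto
      ultimately show "dist (sum g Q) (det_prod c x n) < e"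
        using T0_lim[OF T(1,3,2)] T0_lim[OF T0(1) _ T0(2)] by (auto simp: dist_real_def)
    qed
  qed
  then show ?thesis
    unfolding fredholm_det_def E_def[symmetric] Let_def g_def by (rule infsumI)
qed

section \<open>Information gain\<close>

lemma weighted_sum_cong:
  "(\<And>j. 1 \<le> j \<Longrightarrow> j \<le> n \<Longrightarrow> c j = d j \<and> x j = z j) \<Longrightarrow> weighted_sum c x n = weighted_sum d z n"
  unfolding weighted_sum_def by (intro sum.cong) auto

text \<open>Weighted sums with nonnegative weights, freed from a particular list of vectors: this
  allows adding two operators given by different lists, and induction over rank-one
  summands.\<close>

inductive nonneg_finite_rank :: "('a::real_inner \<Rightarrow>\<^sub>L 'a) \<Rightarrow> bool" where
  zero: "nonneg_finite_rank 0"
| add_rank_one: "nonneg_finite_rank A \<Longrightarrow> 0 \<le> c \<Longrightarrow> nonneg_finite_rank (A + c *\<^sub>R rank_one x)"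

lemma nonneg_finite_rank_imp_weighted_sum:
  "nonneg_finite_rank A \<Longrightarrow> \<exists>c x n. (\<forall>j. 0 \<le> c j) \<and> A = weighted_sum c x n"
proof (induction rule: nonneg_finite_rank.induct)
  case zero
  show ?case by (intro exI[of _ "\<lambda>_. 0"] exI[of _ 0]) simp
next
  case (add_rank_one A c z)
  then obtain d x n where d: "\<And>j. 0 \<le> d j" and A: "A = weighted_sum d x n" by blast
  have "weighted_sum (d(Suc n := c)) (x(Suc n := z)) n = weighted_sum d x n"
    by (rule weighted_sum_cong) auto
  then have "A + c *\<^sub>R rank_one z = weighted_sum (d(Suc n := c)) (x(Suc n := z)) (Suc n)"
    by (simp add: weighted_sum_Suc A)
  moreover have "\<forall>j. 0 \<le> (d(Suc n := c)) j" using d add_rank_one by simp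
  ultimately show ?case by blast
qed

lemma nonneg_finite_rank_add:
  "nonneg_finite_rank B \<Longrightarrow> nonneg_finite_rank A \<Longrightarrow> nonneg_finite_rank (A + B)"
proof (induction rule: nonneg_finite_rank.induct)
  case (add_rank_one B c x)
  then show ?case
    using nonneg_finite_rank.add_rank_one[of "A + B" c x] by (simp add: add.assoc)
qed simp

lemma nonneg_finite_rank_weighted_sum:
  "(\<And>j. 1 \<le> j \<Longrightarrow> j \<le> n \<Longrightarrow> 0 \<le> c j) \<Longrightarrow> nonneg_finite_rank (weighted_sum c x n)"
  by (induction n) (auto simp: weighted_sum_Suc intro: nonneg_finite_rank.intros)

text \<open>Append \<open>z\<close> to a list representing \<open>A\<close>: then w = <z, (I +
  A)^(-1) z> comes from the last factor of \<open>det_prod\<close>, and the resolvent bounds give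
  its range.\<close>

lemma fredholm_det_add_rank_one:
  fixes A :: "'a::{real_inner,second_countable_topology} \<Rightarrow>\<^sub>L 'a"
  assumes "nonneg_finite_rank A" "0 \<le> c"
  shows "\<exists>w. 0 \<le> w \<and> w \<le> (norm z)\<^sup>2 \<and> fredholm_det (A + c *\<^sub>R rank_one z) = fredholm_det A * (1 + c * w)"
proof -
  obtain d x n where d: "\<And>j. 0 \<le> d j" and A: "A = weighted_sum d x n"
    using nonneg_finite_rank_imp_weighted_sum[OF assms(1)] by blast
  define d' x' where "d' = d(Suc n := c)" and "x' = x(Suc n := z)"
  have d': "0 \<le> d' j" for j using d assms(2) unfolding d'_def by simp
  have A': "A = weighted_sum d' x' n" unfolding A d'_def x'_def by (rule weighted_sum_cong) auto
  have "A + c *\<^sub>R rank_one z = weighted_sum d' x' (Suc n)"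
    unfolding A' weighted_sum_Suc by (simp add: d'_def x'_def)
  then have "fredholm_det (A + c *\<^sub>R rank_one z) = det_prod d' x' (Suc n)"
    using fredholm_det_weighted_sum[of d', OF d'] by simp
  also have "\<dots> = fredholm_det A * (1 + c * (z \<bullet> blinfun_apply (resolv 1 d' x' n) z))"
    unfolding det_prod_Suc A' fredholm_det_weighted_sum[of d', OF d'] by (simp add: d'_def x'_def)
  finally show ?thesis
    using resolv_form_nonneg[of d' 1, OF d'] resolv_form_le[of d' 1, OF d'] by fastforce
qed

lemma fredholm_det_zero [simp]:
  "fredholm_det (0 :: 'a::{real_inner,second_countable_topology} \<Rightarrow>\<^sub>L 'a) = 1"
  using fredholm_det_weighted_sum[of "\<lambda>_. 0" "\<lambda>_. 0 :: 'a" 0] by simp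

lemma fredholm_det_ge_1:
  fixes A :: "'a::{real_inner,second_countable_topology} \<Rightarrow>\<^sub>L 'a"
  shows "nonneg_finite_rank A \<Longrightarrow> 1 \<le> fredholm_det A"
proof (induction rule: nonneg_finite_rank.induct)
  case (add_rank_one A c x)
  obtain w where "0 \<le> w" "fredholm_det (A + c *\<^sub>R rank_one x) = fredholm_det A * (1 + c * w)"
    using fredholm_det_add_rank_one[OF add_rank_one(1,2)] by blast
  then show ?case using add_rank_one mult_mono[of 1 "fredholm_det A" 1 "1 + c * w"] by simp
qed simp

lemma fredholm_det_mono_add:
  fixes A :: "'a::{real_inner,second_countable_topology} \<Rightarrow>\<^sub>L 'a"
  shows "nonneg_finite_rank B \<Longrightarrow> nonneg_finite_rank A \<Longrightarrow> fredholm_det A \<le> fredholm_det (A + B)"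
proof (induction rule: nonneg_finite_rank.induct)
  case (add_rank_one B c x)
  have AB: "nonneg_finite_rank (A + B)" using add_rank_one nonneg_finite_rank_add by blast
  obtain w where w: "0 \<le> w"
    "fredholm_det (A + B + c *\<^sub>R rank_one x) = fredholm_det (A + B) * (1 + c * w)"
    using fredholm_det_add_rank_one[OF AB add_rank_one(2)] by blast
  have "fredholm_det (A + B) * 1 \<le> fredholm_det (A + B) * (1 + c * w)"
    using fredholm_det_ge_1[OF AB] w(1) add_rank_one(2) by (intro mult_left_mono) auto
  then show ?case using add_rank_one w(2) by (simp add: add.assoc)
qed simp

lemma info_gain_mono_add:
  fixes A :: "'a::{real_inner,second_countable_topology} \<Rightarrow>\<^sub>L 'a"
  assumes "nonneg_finite_rank A" "nonneg_finite_rank B"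
  shows "info_gain A \<le> info_gain (A + B)"
  using fredholm_det_mono_add[OF assms(2,1)] fredholm_det_ge_1[OF assms(1)]
  unfolding info_gain_def by simp

lemma weighted_sum_diff: "weighted_sum c x n + weighted_sum (\<lambda>j. d j - c j) x n = weighted_sum d x n"
  unfolding weighted_sum_def sum.distrib[symmetric] scaleR_add_left[symmetric] by simp

lemma info_gain_weighted_sum_mono:
  fixes x :: "nat \<Rightarrow> 'a::{real_inner,second_countable_topology}"
  assumes "\<And>j. 1 \<le> j \<Longrightarrow> j \<le> n \<Longrightarrow> 0 \<le> c j \<and> c j \<le> d j"
  shows "info_gain (weighted_sum c x n) \<le> info_gain (weighted_sum d x n)"
  unfolding weighted_sum_diff[of c x n d, symmetric]
  by (intro info_gain_mono_add nonneg_finite_rank_weighted_sum) (use assms in auto)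

lemma info_gain_weighted_sum_mono_length:
  fixes x :: "nat \<Rightarrow> 'a::{real_inner,second_countable_topology}"
  assumes c: "\<And>j. 0 \<le> c j" and "m \<le> n"
  shows "info_gain (weighted_sum c x m) \<le> info_gain (weighted_sum c x n)"
  using \<open>m \<le> n\<close>
proof (induction rule: dec_induct)
  case (step n)
  have "nonneg_finite_rank (c (Suc n) *\<^sub>R rank_one (x (Suc n)))"
    using nonneg_finite_rank.add_rank_one[OF nonneg_finite_rank.zero c[of "Suc n"], of "x (Suc n)"]
    by simp
  then have "info_gain (weighted_sum c x n) \<le> info_gain (weighted_sum c x (Suc n))"
    unfolding weighted_sum_Suc
    by (rule info_gain_mono_add[OF nonneg_finite_rank_weighted_sum[OF c]])
  then show ?case using step by simp
qed simp

text \<open>Each vector of the unit ball contributes ln (1 + c w) <= c w <= c to the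
  log-determinant.\<close>

lemma info_gain_weighted_sum_le:
  fixes x :: "nat \<Rightarrow> 'a::{real_inner,second_countable_topology}"
  assumes c: "\<And>j. 0 \<le> c j" and x: "\<And>j. 1 \<le> j \<Longrightarrow> j \<le> n \<Longrightarrow> norm (x j) \<le> 1"
  shows "info_gain (weighted_sum c x n) \<le> (\<Sum>j=1..n. c j) / 2"
  using x
proof (induction n)
  case 0
  show ?case by (simp add: info_gain_def)
next
  case (Suc n)
  let ?A = "weighted_sum c x n"
  have A: "nonneg_finite_rank ?A" by (rule nonneg_finite_rank_weighted_sum[OF c])
  obtain w where w: "0 \<le> w" "w \<le> (norm (x (Suc n)))\<^sup>2"
    "fredholm_det (weighted_sum c x (Suc n)) = fredholm_det ?A * (1 + c (Suc n) * w)"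
    using fredholm_det_add_rank_one[OF A c[of "Suc n"]] unfolding weighted_sum_Suc by blast
  have "(norm (x (Suc n)))\<^sup>2 \<le> 1" using Suc.prems[of "Suc n"] by (simp add: power_le_one)
  then have "c (Suc n) * w \<le> c (Suc n) * 1" using w c by (intro mult_left_mono) auto
  moreover have "ln (1 + c (Suc n) * w) \<le> c (Suc n) * w" using w c by (intro ln_add_one_self_le_self) auto
  moreover have "ln (fredholm_det ?A * (1 + c (Suc n) * w)) = ln (fredholm_det ?A) + ln (1 + c (Suc n) * w)"
    using fredholm_det_ge_1[OF A] w(1) c[of "Suc n"] by (intro ln_mult_pos) (auto simp: add_pos_nonneg)
  ultimately show ?case using Suc unfolding info_gain_def w(3) by simp
qed

text \<open>After rescaling to regularization 1 the summands are the logarithms of the factors of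
  \<open>det_prod\<close>; weights at most 1 may then be raised to 1 by monotonicity of the
  gain.\<close>

lemma sum_ln_resolv_form_le:
  fixes x :: "nat \<Rightarrow> 'a::{real_inner,second_countable_topology}"
  assumes c: "\<And>j. 0 \<le> c j" and c1: "\<And>j. 1 \<le> j \<Longrightarrow> j \<le> n \<Longrightarrow> c j \<le> 1" and \<rho>: "0 < \<rho>"
  shows "(\<Sum>j=1..n. ln (1 + c j * (x j \<bullet> blinfun_apply (resolv \<rho> c x (j - 1)) (x j))))
    \<le> 2 * info_gain (weighted_sum (\<lambda>_. 1 / \<rho>) x n)"
proof -
  have c\<rho>: "0 \<le> c j / \<rho>" for j using c[of j] \<rho> by simp
  have "(\<Sum>j=1..n. ln (1 + c j * (x j \<bullet> blinfun_apply (resolv \<rho> c x (j - 1)) (x j))))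
    = (\<Sum>j=1..n. ln (1 + c j / \<rho> * (x j \<bullet> blinfun_apply (resolv 1 (\<lambda>j. c j / \<rho>) x (j - 1)) (x j))))"
    unfolding resolv_scale[of c \<rho>, OF c \<rho>] using \<rho> by (simp add: blinfun.scaleR_left)
  also have "\<dots> = ln (det_prod (\<lambda>j. c j / \<rho>) x n)"
    unfolding det_prod_def
  proof (rule ln_prod[symmetric], simp)
    fix j
    have "0 < 1 + c j / \<rho> * (x j \<bullet> blinfun_apply (resolv 1 (\<lambda>j. c j / \<rho>) x (j - 1)) (x j))"
      by (intro add_pos_nonneg mult_nonneg_nonneg c\<rho> resolv_form_nonneg) auto
    then show "1 + c j / \<rho> * (x j \<bullet> blinfun_apply (resolv 1 (\<lambda>j. c j / \<rho>) x (j - 1)) (x j)) \<noteq> 0"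
      by linarith
  qed
  also have "\<dots> = 2 * info_gain (weighted_sum (\<lambda>j. c j / \<rho>) x n)"
    unfolding info_gain_def fredholm_det_weighted_sum[of "\<lambda>j. c j / \<rho>", OF c\<rho>] by simp
  also have "\<dots> \<le> 2 * info_gain (weighted_sum (\<lambda>_. 1 / \<rho>) x n)"
    using info_gain_weighted_sum_mono[of n "\<lambda>j. c j / \<rho>" "\<lambda>_. 1 / \<rho>" x] c c1 \<rho>
    by (simp add: divide_right_mono)
  finally show ?thesis .
qed

lemma V_op_scale: "inverse \<rho> *\<^sub>R V_op X n \<omega> = weighted_sum (\<lambda>_. 1 / \<rho>) (\<lambda>j. X j \<omega>) n"
  unfolding V_op_def weighted_sum_def by (simp add: scaleR_sum_right divide_inverse)

lemma Q_op_eq: "Q_op P F X Y n \<omega> = weighted_sum (\<lambda>j. cond_sq P F Y j \<omega>) (\<lambda>j. X j \<omega>) n"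
  unfolding Q_op_def weighted_sum_def ..

lemma cond_sq_nonneg: "0 \<le> cond_sq P F Y j \<omega>"
  unfolding cond_sq_def by simp

text \<open>Eliminates both unique-choice operators of the definition, so that the proof can work
  with the quadratic form of \<open>resolv\<close>.\<close>

lemma Z_norm_sq:
  fixes X :: "nat \<Rightarrow> 'w \<Rightarrow> 'a::{real_inner,banach}"
  assumes "0 < \<rho>"
  shows "(Z_norm P F X Y n \<rho> \<omega>)\<^sup>2 = M_sum X Y n \<omega> \<bullet>
    blinfun_apply (resolv \<rho> (\<lambda>j. cond_sq P F Y j \<omega>) (\<lambda>j. X j \<omega>) n) (M_sum X Y n \<omega>)"
  unfolding Z_norm_def Q_op_eq
  using op_inverse_weighted_sum[of "\<lambda>j. cond_sq P F Y j \<omega>" \<rho>, OF cond_sq_nonneg assms]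
    norm_op_sqrt_resolv[of "\<lambda>j. cond_sq P F Y j \<omega>" \<rho>, OF cond_sq_nonneg assms] by metis

section \<open>The critical level gamma*: feasibility, monotonicity and growth in n\<close>

context
  fixes X :: "nat \<Rightarrow> 'w \<Rightarrow> 'a::{real_inner,second_countable_topology}" and \<omega> :: 'w and n :: nat
  assumes X: "\<And>j. 1 \<le> j \<Longrightarrow> j \<le> n \<Longrightarrow> norm (X j \<omega>) \<le> 1"
begin

lemma info_gain_V_op_antimono:
  assumes "0 < \<rho>" "\<rho> \<le> r"
  shows "info_gain (inverse r *\<^sub>R V_op X n \<omega>) \<le> info_gain (inverse \<rho> *\<^sub>R V_op X n \<omega>)"
  unfolding V_op_scale by (intro info_gain_weighted_sum_mono) (use assms in \<open>auto simp: frac_le\<close>)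

lemma info_gain_V_op_le:
  assumes "0 < \<rho>"
  shows "info_gain (inverse \<rho> *\<^sub>R V_op X n \<omega>) \<le> real n / (2 * \<rho>)"
  using info_gain_weighted_sum_le[of "\<lambda>_. 1 / \<rho>" n "\<lambda>j. X j \<omega>"] X assms unfolding V_op_scale
  by (simp add: field_simps)

text \<open>The gain is at most n / (2 \<rho>), and sqrt (n / 2) solves n / (2 \<rho>) =
  \<rho>.\<close>

lemma gamma_star_set_nonempty:
  "max 1 (sqrt (real n / 2)) \<in> {\<rho>. \<rho> \<ge> 1 \<and> \<rho> \<ge> info_gain (inverse \<rho> *\<^sub>R V_op X n \<omega>)}"
proof -
  define \<rho> where "\<rho> = max 1 (sqrt (real n / 2))"
  have \<rho>: "1 \<le> \<rho>" "sqrt (real n / 2) \<le> \<rho>" unfolding \<rho>_def by auto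
  have "real n / 2 = (sqrt (real n / 2))\<^sup>2" by simp
  also have "\<dots> \<le> \<rho>\<^sup>2" using \<rho>(2) by (intro power_mono) auto
  finally have "real n / (2 * \<rho>) \<le> \<rho>" using \<rho>(1) by (simp add: field_simps power2_eq_square)
  then show ?thesis using info_gain_V_op_le[of \<rho>] \<rho> unfolding \<rho>_def[symmetric] by simp
qed

lemma gamma_star_ge_1: "1 \<le> gamma_star X n \<omega>"
  unfolding gamma_star_def using gamma_star_set_nonempty by (intro cInf_greatest) blast+

lemma gamma_star_less_iff:
  "gamma_star X n \<omega> < r \<longleftrightarrow> (\<exists>q. 1 \<le> q \<and> q < r \<and> info_gain (inverse q *\<^sub>R V_op X n \<omega>) \<le> q)"
proof -
  let ?S = "{\<rho>. \<rho> \<ge> 1 \<and> \<rho> \<ge> info_gain (inverse \<rho> *\<^sub>R V_op X n \<omega>)}"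
  have "?S \<noteq> {}" "bdd_below ?S" using gamma_star_set_nonempty by (blast, intro bdd_belowI[of _ 1]) auto
  then show ?thesis unfolding gamma_star_def by (subst cInf_less_iff) auto
qed

text \<open>The gain decreases in \<rho>, so the levels in the infimum form an upward closed set;
  strictness avoids the question whether the infimum is attained.\<close>

lemma info_gain_le_of_gamma_star_less:
  assumes "gamma_star X n \<omega> < r"
  shows "info_gain (inverse r *\<^sub>R V_op X n \<omega>) \<le> r"
proof -
  obtain q where "1 \<le> q" "q < r" "info_gain (inverse q *\<^sub>R V_op X n \<omega>) \<le> q"
    using assms unfolding gamma_star_less_iff by blast
  then show ?thesis using info_gain_V_op_antimono[of q r] by simp
qed

text \<open>Upward closedness moves the witness to a rational, which turns the event into a
  countable union and yields measurability.\<close>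

lemma gamma_star_less_iff_rat:
  "gamma_star X n \<omega> < r \<longleftrightarrow>
    (\<exists>q\<in>\<rat>. 1 \<le> q \<and> q < r \<and> info_gain (inverse q *\<^sub>R V_op X n \<omega>) \<le> q)"
proof
  assume "gamma_star X n \<omega> < r"
  then obtain p where p: "1 \<le> p" "p < r" "info_gain (inverse p *\<^sub>R V_op X n \<omega>) \<le> p"
    unfolding gamma_star_less_iff by blast
  obtain q where q: "q \<in> \<rat>" "p < q" "q < r" using Rats_dense_in_real[OF p(2)] by blast
  have "info_gain (inverse q *\<^sub>R V_op X n \<omega>) \<le> q"
    using info_gain_V_op_antimono[of p q] p q by simp
  then show "\<exists>q\<in>\<rat>. 1 \<le> q \<and> q < r \<and> info_gain (inverse q *\<^sub>R V_op X n \<omega>) \<le> q"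
    using p q by (intro bexI[of _ q]) auto
qed (auto simp: gamma_star_less_iff)

lemma power4_le_of_gamma_star_ge:
  assumes "2 ^ k \<le> gamma_star X n \<omega>" "1 \<le> n"
  shows "4 ^ k \<le> n"
proof (cases "k = 0")
  case False
  have "gamma_star X n \<omega> \<le> max 1 (sqrt (real n / 2))"
    unfolding gamma_star_def by (rule cInf_lower[OF gamma_star_set_nonempty bdd_belowI[of _ 1]]) auto
  then have "2 ^ k \<le> max 1 (sqrt (real n / 2))" using assms by simp
  moreover have "1 < (2::real) ^ k" using False by simp
  ultimately have "2 ^ k \<le> sqrt (real n / 2)" by simp
  then have "(2 ^ k)\<^sup>2 \<le> (sqrt (real n / 2))\<^sup>2" by (intro power_mono) auto
  then have "(2 ^ k)\<^sup>2 \<le> real n / 2" by simp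
  moreover have "((2::real) ^ k)\<^sup>2 = 4 ^ k"
    unfolding power2_eq_square power_mult_distrib[symmetric] by simp
  moreover have "(0::real) \<le> 4 ^ k" by simp
  ultimately have "(4::real) ^ k \<le> real n" by linarith
  then have "real (4 ^ k) \<le> real n" by (simp only: of_nat_power of_nat_numeral)
  then show ?thesis by (simp only: of_nat_le_iff)
qed (use assms in simp)

end

section \<open>Measurability of resolvents, information gain and gamma*\<close>

lemma borel_measurable_resolv:
  fixes x :: "nat \<Rightarrow> 'w \<Rightarrow> 'a::{real_inner,second_countable_topology}"
  assumes "\<And>j. 1 \<le> j \<Longrightarrow> j \<le> n \<Longrightarrow> x j \<in> borel_measurable N"
    and "\<And>j. 1 \<le> j \<Longrightarrow> j \<le> n \<Longrightarrow> c j \<in> borel_measurable N"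
    and "\<rho> \<in> borel_measurable N" and "u \<in> borel_measurable N"
  shows "(\<lambda>\<omega>. blinfun_apply (resolv (\<rho> \<omega>) (\<lambda>j. c j \<omega>) (\<lambda>j. x j \<omega>) n) (u \<omega>)) \<in> borel_measurable N"
  using assms
proof (induction n arbitrary: u)
  case 0
  then show ?case by (simp add: blinfun.scaleR_left)
next
  case (Suc n)
  have [measurable]: "x (Suc n) \<in> borel_measurable N" "c (Suc n) \<in> borel_measurable N"
    "\<rho> \<in> borel_measurable N" "u \<in> borel_measurable N"
    using Suc.prems by auto
  have [measurable]: "(\<lambda>\<omega>. blinfun_apply (resolv (\<rho> \<omega>) (\<lambda>j. c j \<omega>) (\<lambda>j. x j \<omega>) n) (v \<omega>)) \<in> borel_measurable N"
    if "v \<in> borel_measurable N" for v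
    using Suc.IH[of v] that Suc.prems by auto
  show ?case by (simp add: blinfun.bilinear_simps)
qed

lemma borel_measurable_info_gain_V_op:
  fixes X :: "nat \<Rightarrow> 'w \<Rightarrow> 'a::{real_inner,second_countable_topology}"
  assumes X: "\<And>j. 1 \<le> j \<Longrightarrow> j \<le> n \<Longrightarrow> X j \<in> borel_measurable N" and "0 < \<rho>"
  shows "(\<lambda>\<omega>. info_gain (inverse \<rho> *\<^sub>R V_op X n \<omega>)) \<in> borel_measurable N"
proof -
  have "(\<lambda>\<omega>. (X j \<omega>) \<bullet> blinfun_apply (resolv 1 (\<lambda>_. 1 / \<rho>) (\<lambda>j. X j \<omega>) (j - 1)) (X j \<omega>)) \<in> borel_measurable N"
    if "1 \<le> j" "j \<le> n" for j
    using that by (intro borel_measurable_inner X borel_measurable_resolv) auto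
  then have "(\<lambda>\<omega>. det_prod (\<lambda>_. 1 / \<rho>) (\<lambda>j. X j \<omega>) n) \<in> borel_measurable N"
    unfolding det_prod_def
    by (intro borel_measurable_prod borel_measurable_add borel_measurable_times borel_measurable_const) auto
  moreover have eq: "info_gain (inverse \<rho> *\<^sub>R V_op X n \<omega>) = 1 / 2 * ln (det_prod (\<lambda>_. 1 / \<rho>) (\<lambda>j. X j \<omega>) n)"
    for \<omega>
    unfolding info_gain_def V_op_scale
    by (subst fredholm_det_weighted_sum) (use \<open>0 < \<rho>\<close> in auto)
  ultimately show ?thesis
    unfolding eq by (intro borel_measurable_times borel_measurable_const borel_measurable_ln)
qed

lemma borel_measurable_gamma_star:
  fixes X :: "nat \<Rightarrow> 'w \<Rightarrow> 'a::{real_inner,second_countable_topology}"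
  assumes X: "\<And>j. 1 \<le> j \<Longrightarrow> j \<le> n \<Longrightarrow> X j \<in> borel_measurable N"
    and X1: "\<And>j \<omega>. 1 \<le> j \<Longrightarrow> j \<le> n \<Longrightarrow> \<omega> \<in> space N \<Longrightarrow> norm (X j \<omega>) \<le> 1"
  shows "gamma_star X n \<in> borel_measurable N"
proof (subst borel_measurable_iff_less, rule allI)
  fix r :: real
  have "{\<omega> \<in> space N. gamma_star X n \<omega> < r} = (\<Union>q\<in>{q\<in>\<rat>. 1 \<le> q \<and> q < r}.
      {\<omega> \<in> space N. info_gain (inverse q *\<^sub>R V_op X n \<omega>) \<le> q})"
    using gamma_star_less_iff_rat[where X = X and n = n] X1 by blast
  also have "\<dots> \<in> sets N"
  proof (rule sets.countable_UN'')
    show "countable {q\<in>\<rat>. 1 \<le> q \<and> q < r}"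
      using countable_rat by (rule countable_subset[rotated]) auto
    fix q assume "q \<in> {q\<in>\<rat>. 1 \<le> q \<and> q < r}"
    then have [measurable]: "(\<lambda>\<omega>. info_gain (inverse q *\<^sub>R V_op X n \<omega>)) \<in> borel_measurable N"
      by (intro borel_measurable_info_gain_V_op X) auto
    show "{\<omega> \<in> space N. info_gain (inverse q *\<^sub>R V_op X n \<omega>) \<le> q} \<in> sets N" by measurable
  qed
  finally show "{\<omega> \<in> space N. gamma_star X n \<omega> < r} \<in> sets N" .
qed

section \<open>A conditional moment generating function bound\<close>

text \<open>For negative \<open>t\<close> use (1 + t + t^2)(1 - t) = 1 - t^3 >= 1 together with 1 -
  t <= exp (- t).\<close>

lemma exp_le_quadratic:
  fixes t :: real
  assumes "\<bar>t\<bar> \<le> 1"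
  shows "exp t \<le> 1 + t + t\<^sup>2"
proof (cases "0 \<le> t")
  case True
  then show ?thesis using exp_bound[of t] assms by simp
next
  case False
  have "1 \<le> (1 + t + t\<^sup>2) * (1 - t)"
    using False by (simp add: power2_eq_square algebra_simps mult_nonpos_nonneg)
  also have "\<dots> \<le> (1 + t + t\<^sup>2) * exp (- t)"
  proof (rule mult_left_mono)
    show "1 - t \<le> exp (- t)" using exp_ge_add_one_self[of "- t"] by simp
    show "0 \<le> 1 + t + t\<^sup>2" using assms False by (simp add: add_nonneg_nonneg)
  qed
  finally show ?thesis by (simp add: exp_minus field_simps)
qed

lemma ln_one_plus_lower:
  fixes t :: real
  assumes "0 \<le> t"
  shows "t / (1 + t) \<le> ln (1 + t)"
  using ln_le_minus_one[of "1 / (1 + t)"] assms by (simp add: ln_div field_simps)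

text \<open>One step given the past: \<open>s\<close> is the conditional variance, \<open>w\<close>
  and \<open>a\<close> are predictable scalars. The predictable part of the exponent goes into
  \<open>U\<close>; the exponential of the rest is bounded by 1 + \<alpha> Y + \<beta> Y^2, whose
  conditional mean is 1 + \<beta> s.\<close>

context
  fixes s w a \<eta> b U \<alpha> \<beta> :: real
  assumes s: "0 \<le> s" and w: "0 \<le> w" "w \<le> 1 / 2" and \<eta>: "0 < \<eta>" "\<eta> \<le> 1 / 8"
    and small: "\<eta> * (2 * \<bar>a\<bar> + w) \<le> 1"
  defines "b \<equiv> 1 / (1 + s * w)"
    and "U \<equiv> exp (- (\<eta> * b * s * a\<^sup>2) - 9 / 8 * \<eta> * ln (1 + s * w))"
    and "\<alpha> \<equiv> 2 * \<eta> * b * a"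
    and "\<beta> \<equiv> \<eta> * b * w + \<eta>\<^sup>2 * b\<^sup>2 * (8 * a\<^sup>2 + 2 * w\<^sup>2)"
begin

lemma damping_bounds: "0 < b" "b \<le> 1"
  unfolding b_def using s w by (auto simp: add_pos_nonneg)

lemma increment_exponent_le:
  assumes Y: "\<bar>Y\<bar> \<le> 1"
  shows "\<bar>\<eta> * b * (2 * Y * a + Y\<^sup>2 * w)\<bar> \<le> 1"
proof -
  have Y2: "Y\<^sup>2 \<le> 1" using Y by (simp add: abs_square_le_1)
  have "\<bar>2 * Y * a + Y\<^sup>2 * w\<bar> \<le> 2 * (\<bar>Y\<bar> * \<bar>a\<bar>) + Y\<^sup>2 * w"
    using w by (simp add: abs_mult abs_triangle_ineq[THEN order_trans])
  also have "\<dots> \<le> 2 * (1 * \<bar>a\<bar>) + 1 * w"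
    using Y Y2 w by (intro add_mono mult_left_mono mult_right_mono) auto
  finally have 1: "\<bar>2 * Y * a + Y\<^sup>2 * w\<bar> \<le> 2 * \<bar>a\<bar> + w" by simp
  have "\<bar>\<eta> * b * (2 * Y * a + Y\<^sup>2 * w)\<bar> = \<eta> * b * \<bar>2 * Y * a + Y\<^sup>2 * w\<bar>"
    using \<eta> damping_bounds by (simp add: abs_mult)
  also have "\<dots> \<le> (\<eta> * 1) * (2 * \<bar>a\<bar> + w)"
    using 1 \<eta> damping_bounds w by (intro mult_mono) auto
  finally show ?thesis using small by simp
qed

lemma exp_increment_le:
  assumes Y: "\<bar>Y\<bar> \<le> 1"
  shows "exp (\<eta> * ((2 * Y * a - s * a\<^sup>2 + Y\<^sup>2 * w) / (1 + s * w)) - 9 / 8 * \<eta> * ln (1 + s * w))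
    \<le> U * (1 + \<alpha> * Y + \<beta> * Y\<^sup>2)"
proof -
  define \<theta> where "\<theta> = \<eta> * b * (2 * Y * a + Y\<^sup>2 * w)"
  have Y2: "Y\<^sup>2 \<le> 1" using Y by (simp add: abs_square_le_1)
  have "(2 * a + Y * w)\<^sup>2 \<le> 8 * a\<^sup>2 + 2 * (Y\<^sup>2 * w\<^sup>2)"
    using zero_le_power2[of "2 * a - Y * w"] by (simp add: power2_eq_square algebra_simps)
  also have "\<dots> \<le> 8 * a\<^sup>2 + 2 * (1 * w\<^sup>2)"
    using Y2 by (intro add_left_mono mult_left_mono mult_right_mono) auto
  finally have 1: "(2 * a + Y * w)\<^sup>2 \<le> 8 * a\<^sup>2 + 2 * w\<^sup>2" by simp
  have "\<theta>\<^sup>2 = (\<eta>\<^sup>2 * b\<^sup>2 * Y\<^sup>2) * (2 * a + Y * w)\<^sup>2"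
    unfolding \<theta>_def by (simp add: power2_eq_square algebra_simps)
  also have "\<dots> \<le> (\<eta>\<^sup>2 * b\<^sup>2 * Y\<^sup>2) * (8 * a\<^sup>2 + 2 * w\<^sup>2)" using 1 by (intro mult_left_mono) auto
  finally have "exp \<theta> \<le> 1 + \<theta> + (\<eta>\<^sup>2 * b\<^sup>2 * Y\<^sup>2) * (8 * a\<^sup>2 + 2 * w\<^sup>2)"
    using exp_le_quadratic[of \<theta>] increment_exponent_le[OF Y] unfolding \<theta>_def by simp
  also have "\<dots> = 1 + \<alpha> * Y + \<beta> * Y\<^sup>2"
    unfolding \<theta>_def \<alpha>_def \<beta>_def by (simp add: power2_eq_square algebra_simps)
  finally have "U * exp \<theta> \<le> U * (1 + \<alpha> * Y + \<beta> * Y\<^sup>2)"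
    by (intro mult_left_mono) (auto simp: U_def)
  moreover have "\<eta> * ((2 * Y * a - s * a\<^sup>2 + Y\<^sup>2 * w) / (1 + s * w)) - 9 / 8 * \<eta> * ln (1 + s * w)
      = (- (\<eta> * b * s * a\<^sup>2) - 9 / 8 * \<eta> * ln (1 + s * w)) + \<theta>"
  proof -
    have "x / (1 + s * w) = b * x" for x unfolding b_def by simp
    then show ?thesis unfolding \<theta>_def by (simp add: algebra_simps)
  qed
  ultimately show ?thesis unfolding U_def by (simp only: exp_add)
qed

lemma discount_bounds: "0 < U" "U \<le> 1"
proof -
  have "0 \<le> \<eta> * b * s * a\<^sup>2" using \<eta> damping_bounds s by simp
  moreover have "0 \<le> \<eta> * ln (1 + s * w)" using \<eta> s w by simp
  ultimately show "U \<le> 1" unfolding U_def by simp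
qed (simp add: U_def)

text \<open>Of the three terms of \<beta> s, the first is \<eta> b s w. The one in a^2 carries the
  extra factor 8 \<eta> b <= 1, whence \<eta> <= 1/8, and is absorbed by the drift. The last is at
  most 1/8 of the first, since \<eta> b w <= 1/16. The total 9/8 \<eta> b s w is compensated because
  b s w = s w / (1 + s w) <= ln (1 + s w).\<close>

lemma compensated_le_1: "U * (1 + \<beta> * s) \<le> 1"
proof -
  have bsw: "b * s * w \<le> ln (1 + s * w)"
    using ln_one_plus_lower[of "s * w"] s w by (simp add: b_def)
  have lb: "\<eta> * b \<le> 1 / 8" using mult_mono[of \<eta> "1 / 8" b 1] \<eta> damping_bounds by simp
  have 1: "(\<eta> * b * s * a\<^sup>2) * (8 * (\<eta> * b)) \<le> (\<eta> * b * s * a\<^sup>2) * 1"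
    using lb \<eta> damping_bounds s by (intro mult_left_mono) auto
  have "(\<eta> * b) * w \<le> 1 / 8 * (1 / 2)" using lb w \<eta> damping_bounds by (intro mult_mono) auto
  then have 2: "(\<eta> * b * s * w) * (2 * (\<eta> * b * w)) \<le> (\<eta> * b * s * w) * (1 / 8)"
    using \<eta> damping_bounds s w by (intro mult_left_mono) auto
  have "\<beta> * s = \<eta> * b * s * w + (\<eta> * b * s * a\<^sup>2) * (8 * (\<eta> * b)) + (\<eta> * b * s * w) * (2 * (\<eta> * b * w))"
    unfolding \<beta>_def by (simp add: power2_eq_square algebra_simps)
  also have "\<dots> \<le> \<eta> * b * s * a\<^sup>2 + 9 / 8 * \<eta> * (b * s * w)" using 1 2 by simp
  also have "\<dots> \<le> \<eta> * b * s * a\<^sup>2 + 9 / 8 * \<eta> * ln (1 + s * w)"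
    using bsw \<eta> by (intro add_left_mono mult_left_mono) auto
  finally have "1 + \<beta> * s \<le> exp (\<eta> * b * s * a\<^sup>2 + 9 / 8 * \<eta> * ln (1 + s * w))"
    using exp_ge_add_one_self[of "\<eta> * b * s * a\<^sup>2 + 9 / 8 * \<eta> * ln (1 + s * w)"] by linarith
  then have "U * (1 + \<beta> * s) \<le> U * exp (\<eta> * b * s * a\<^sup>2 + 9 / 8 * \<eta> * ln (1 + s * w))"
    using discount_bounds by (intro mult_left_mono) auto
  also have "\<dots> = 1" unfolding U_def exp_add[symmetric] by simp
  finally show ?thesis .
qed

text \<open>Crude bounds for integrability: \<open>small\<close> gives \<eta> |a| <= 1/2, and 5 = 1
  + 8/4 + 2.\<close>

lemma coeff_bounds: "\<bar>\<alpha>\<bar> \<le> 1" "0 \<le> \<beta>" "\<beta> \<le> 5"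
proof -
  have "2 * (\<eta> * \<bar>a\<bar>) + \<eta> * w = \<eta> * (2 * \<bar>a\<bar> + w)" by (simp add: distrib_left)
  moreover have "0 \<le> \<eta> * w" using \<eta> w by simp
  ultimately have a: "\<eta> * \<bar>a\<bar> \<le> 1 / 2" using small by linarith
  have "\<bar>\<alpha>\<bar> = b * (2 * (\<eta> * \<bar>a\<bar>))" unfolding \<alpha>_def using damping_bounds \<eta> by (simp add: abs_mult)
  also have "\<dots> \<le> 1 * 1" using a damping_bounds \<eta> by (intro mult_mono) auto
  finally show "\<bar>\<alpha>\<bar> \<le> 1" by simp
  show "0 \<le> \<beta>" unfolding \<beta>_def using \<eta> damping_bounds w by simp
  have b2: "b\<^sup>2 \<le> 1" using damping_bounds by (simp add: power_le_one)
  have "(\<eta> * \<bar>a\<bar>)\<^sup>2 \<le> (1 / 2)\<^sup>2" using a \<eta> by (intro power_mono) auto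
  moreover have "(\<eta> * w)\<^sup>2 \<le> 1\<^sup>2"
    using mult_mono[of \<eta> "1 / 8" w "1 / 2"] \<eta> w by (intro power_mono) auto
  moreover have "\<eta>\<^sup>2 * (8 * a\<^sup>2 + 2 * w\<^sup>2) = 8 * (\<eta> * \<bar>a\<bar>)\<^sup>2 + 2 * (\<eta> * w)\<^sup>2"
    by (simp add: power_mult_distrib algebra_simps)
  ultimately have 1: "\<eta>\<^sup>2 * (8 * a\<^sup>2 + 2 * w\<^sup>2) \<le> 4" by (simp add: power2_eq_square)
  have "b\<^sup>2 * (\<eta>\<^sup>2 * (8 * a\<^sup>2 + 2 * w\<^sup>2)) \<le> 1 * 4" using 1 b2 by (intro mult_mono) auto
  moreover have "(\<eta> * b) * w \<le> 1 * 1"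
    using mult_mono[of \<eta> 1 b 1] \<eta> damping_bounds w by (intro mult_mono) auto
  ultimately show "\<beta> \<le> 5" unfolding \<beta>_def by (simp add: mult_ac)
qed

end

section \<open>Self-normalized martingales\<close>

lemma resolv_form_Suc:
  fixes x :: "nat \<Rightarrow> 'a::real_inner" and n :: nat
  assumes c: "\<And>j. 0 \<le> c j" and \<rho>: "0 < \<rho>"
  defines "R \<equiv> blinfun_apply (resolv \<rho> c x n)"
  shows "(m + t *\<^sub>R x (Suc n)) \<bullet> blinfun_apply (resolv \<rho> c x (Suc n)) (m + t *\<^sub>R x (Suc n)) =
    m \<bullet> R m + (2 * t * (x (Suc n) \<bullet> R m) - c (Suc n) * (x (Suc n) \<bullet> R m)\<^sup>2
      + t\<^sup>2 * (x (Suc n) \<bullet> R (x (Suc n)))) / (1 + c (Suc n) * (x (Suc n) \<bullet> R (x (Suc n))))"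
proof -
  define z s w a D where "z = x (Suc n)" and "s = c (Suc n)" and "w = z \<bullet> R z" and "a = z \<bullet> R m"
    and "D = 1 + s * w"
  have "0 \<le> w" unfolding w_def R_def by (rule resolv_form_nonneg[OF c \<rho>])
  then have D: "0 < D" unfolding D_def s_def using c[of "Suc n"] by (simp add: add_pos_nonneg)
  have sym: "R u \<bullet> v = u \<bullet> R v" for u v
    unfolding R_def by (rule resolv_sym[OF c \<rho>])
  have R_lin: "R (m + t *\<^sub>R z) = R m + t *\<^sub>R R z"
    unfolding R_def by (simp add: blinfun.add_right blinfun.scaleR_right)
  have app: "blinfun_apply (resolv \<rho> c x (Suc n)) u = R u - (s / D * (R z \<bullet> u)) *\<^sub>R R z" for u
    by (simp add: blinfun.bilinear_simps R_def z_def s_def w_def D_def)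
  have mRz: "m \<bullet> R z = a" unfolding a_def using sym[of m z] by (simp add: inner_commute)
  have Rzm: "R z \<bullet> (m + t *\<^sub>R z) = a + t * w"
    unfolding sym by (simp add: R_lin inner_add_right a_def w_def)
  have "(m + t *\<^sub>R z) \<bullet> blinfun_apply (resolv \<rho> c x (Suc n)) (m + t *\<^sub>R z)
      = (m + t *\<^sub>R z) \<bullet> R (m + t *\<^sub>R z) - s / D * (a + t * w)\<^sup>2"
    unfolding app inner_diff_right inner_scaleR_right Rzm
    using Rzm by (simp add: inner_commute power2_eq_square)
  also have "(m + t *\<^sub>R z) \<bullet> R (m + t *\<^sub>R z) = m \<bullet> R m + (2 * t * a + t\<^sup>2 * w)"
    unfolding R_lin
    by (simp add: inner_add_left inner_add_right mRz a_def[symmetric] w_def[symmetric]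
        power2_eq_square algebra_simps)
  also have "m \<bullet> R m + (2 * t * a + t\<^sup>2 * w) - s / D * (a + t * w)\<^sup>2
      = m \<bullet> R m + ((2 * t * a + t\<^sup>2 * w) * D - s * (a + t * w)\<^sup>2) / D"
    using D by (simp add: diff_divide_distrib)
  \<comment> \<open>The terms in a t w and t^2 w^2 cancel, so the numerator is free of products of
    \<open>w\<close> with \<open>a\<close> or with itself.\<close>
  also have "(2 * t * a + t\<^sup>2 * w) * D - s * (a + t * w)\<^sup>2 = 2 * t * a - s * a\<^sup>2 + t\<^sup>2 * w"
    unfolding D_def by (simp add: power2_eq_square algebra_simps)
  finally show ?thesis unfolding z_def s_def w_def a_def D_def .
qed

text \<open>The coefficients are \<open>G\<close>-measurable, so conditional expectations may be
  inserted beside them: the linear term has mean zero and Y^2 is replaced by its conditional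
  variance. Boundedness makes each product integrable.\<close>

lemma (in prob_space) expectation_quadratic_increment:
  fixes Y H\<^sub>0 H\<^sub>1 H\<^sub>2 s :: "'a \<Rightarrow> real"
  assumes sub: "subalgebra M G"
    and Y[measurable]: "Y \<in> borel_measurable M" and Y1: "AE \<omega> in M. \<bar>Y \<omega>\<bar> \<le> 1"
    and mean: "AE \<omega> in M. real_cond_exp M G Y \<omega> = 0"
    and var: "AE \<omega> in M. real_cond_exp M G (\<lambda>\<omega>. (Y \<omega>)\<^sup>2) \<omega> = s \<omega>"
    and s[measurable]: "s \<in> borel_measurable M"
    and H: "H\<^sub>0 \<in> borel_measurable G" "H\<^sub>1 \<in> borel_measurable G" "H\<^sub>2 \<in> borel_measurable G"
    and bd: "AE \<omega> in M. \<bar>H\<^sub>0 \<omega>\<bar> \<le> C" "AE \<omega> in M. \<bar>H\<^sub>1 \<omega>\<bar> \<le> C" "AE \<omega> in M. \<bar>H\<^sub>2 \<omega>\<bar> \<le> C"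
  shows "integrable M (\<lambda>\<omega>. H\<^sub>0 \<omega> + H\<^sub>1 \<omega> * Y \<omega> + H\<^sub>2 \<omega> * (Y \<omega>)\<^sup>2)"
    and "integrable M (\<lambda>\<omega>. H\<^sub>0 \<omega> + H\<^sub>2 \<omega> * s \<omega>)"
    and "(\<integral>\<omega>. H\<^sub>0 \<omega> + H\<^sub>1 \<omega> * Y \<omega> + H\<^sub>2 \<omega> * (Y \<omega>)\<^sup>2 \<partial>M) = (\<integral>\<omega>. H\<^sub>0 \<omega> + H\<^sub>2 \<omega> * s \<omega> \<partial>M)"
proof -
  interpret G: finite_measure_subalgebra M G by unfold_locales (rule sub)
  have [measurable]: "H\<^sub>0 \<in> borel_measurable M" "H\<^sub>1 \<in> borel_measurable M" "H\<^sub>2 \<in> borel_measurable M"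
    using H measurable_from_subalg[OF sub] by auto
  have i0: "integrable M H\<^sub>0" using bd(1) by (intro integrable_const_bound[of _ C]) auto
  have i1: "integrable M (\<lambda>\<omega>. H\<^sub>1 \<omega> * Y \<omega>)"
  proof (rule integrable_const_bound[of _ C])
    show "AE \<omega> in M. norm (H\<^sub>1 \<omega> * Y \<omega>) \<le> C"
      using bd(2) Y1
    proof eventually_elim
      case (elim \<omega>)
      then have "\<bar>H\<^sub>1 \<omega>\<bar> * \<bar>Y \<omega>\<bar> \<le> C * 1" by (intro mult_mono) auto
      then show ?case by (simp add: abs_mult)
    qed
  qed measurable
  have i2: "integrable M (\<lambda>\<omega>. H\<^sub>2 \<omega> * (Y \<omega>)\<^sup>2)"
  proof (rule integrable_const_bound[of _ C])
    show "AE \<omega> in M. norm (H\<^sub>2 \<omega> * (Y \<omega>)\<^sup>2) \<le> C"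
      using bd(3) Y1
    proof eventually_elim
      case (elim \<omega>)
      then have "\<bar>H\<^sub>2 \<omega>\<bar> * (Y \<omega>)\<^sup>2 \<le> C * 1" by (intro mult_mono) (auto simp: abs_square_le_1)
      then show ?case by (simp add: abs_mult)
    qed
  qed measurable
  have "integrable M (\<lambda>\<omega>. H\<^sub>2 \<omega> * real_cond_exp M G (\<lambda>\<omega>. (Y \<omega>)\<^sup>2) \<omega>)"
    by (rule G.real_cond_exp_intg(1)[OF i2 H(3)]) measurable
  also have "?this \<longleftrightarrow> integrable M (\<lambda>\<omega>. H\<^sub>2 \<omega> * s \<omega>)"
    using var by (intro integrable_cong_AE) auto
  finally have i2s: "integrable M (\<lambda>\<omega>. H\<^sub>2 \<omega> * s \<omega>)" .
  have e1: "(\<integral>\<omega>. H\<^sub>1 \<omega> * Y \<omega> \<partial>M) = 0"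
  proof -
    have "(\<integral>\<omega>. H\<^sub>1 \<omega> * Y \<omega> \<partial>M) = (\<integral>\<omega>. H\<^sub>1 \<omega> * real_cond_exp M G Y \<omega> \<partial>M)"
      by (rule G.real_cond_exp_intg(2)[OF i1 H(2), symmetric]) measurable
    also have "\<dots> = (\<integral>\<omega>. 0 \<partial>M)" using mean by (intro integral_cong_AE) auto
    finally show ?thesis by simp
  qed
  have e2: "(\<integral>\<omega>. H\<^sub>2 \<omega> * (Y \<omega>)\<^sup>2 \<partial>M) = (\<integral>\<omega>. H\<^sub>2 \<omega> * s \<omega> \<partial>M)"
  proof -
    have "(\<integral>\<omega>. H\<^sub>2 \<omega> * (Y \<omega>)\<^sup>2 \<partial>M) = (\<integral>\<omega>. H\<^sub>2 \<omega> * real_cond_exp M G (\<lambda>\<omega>. (Y \<omega>)\<^sup>2) \<omega> \<partial>M)"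
      by (rule G.real_cond_exp_intg(2)[OF i2 H(3), symmetric]) measurable
    also have "\<dots> = (\<integral>\<omega>. H\<^sub>2 \<omega> * s \<omega> \<partial>M)" using var by (intro integral_cong_AE) auto
    finally show ?thesis .
  qed
  show "integrable M (\<lambda>\<omega>. H\<^sub>0 \<omega> + H\<^sub>1 \<omega> * Y \<omega> + H\<^sub>2 \<omega> * (Y \<omega>)\<^sup>2)"
    and "integrable M (\<lambda>\<omega>. H\<^sub>0 \<omega> + H\<^sub>2 \<omega> * s \<omega>)"
    using i0 i1 i2 i2s by auto
  show "(\<integral>\<omega>. H\<^sub>0 \<omega> + H\<^sub>1 \<omega> * Y \<omega> + H\<^sub>2 \<omega> * (Y \<omega>)\<^sup>2 \<partial>M) = (\<integral>\<omega>. H\<^sub>0 \<omega> + H\<^sub>2 \<omega> * s \<omega> \<partial>M)"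
    using i0 i1 i2 i2s e1 e2 by simp
qed

section \<open>The martingale setting: predictability and conditional variances\<close>

locale self_normalized_martingale = prob_space P
  for P :: "'w measure" +
  fixes F :: "nat \<Rightarrow> 'w measure"
    and X :: "nat \<Rightarrow> 'w \<Rightarrow> 'a::{real_inner, banach, second_countable_topology}"
    and Y :: "nat \<Rightarrow> 'w \<Rightarrow> real"
  assumes filtration: "filtration (space P) F"
    and subalgebra_F: "\<And>n. subalgebra P (F n)"
    and X_meas: "\<And>n. n \<ge> 1 \<Longrightarrow> X n \<in> borel_measurable (F (n - 1))"
    and X_ball: "\<And>n \<omega>. n \<ge> 1 \<Longrightarrow> \<omega> \<in> space P \<Longrightarrow> X n \<omega> \<in> cball 0 1"
    and Y_meas: "\<And>n. n \<ge> 1 \<Longrightarrow> Y n \<in> borel_measurable (F n)"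
    and Y_mean: "\<And>n. n \<ge> 1 \<Longrightarrow> AE \<omega> in P. real_cond_exp P (F (n - 1)) (Y n) \<omega> = 0"
    and Y_bound: "\<And>n. n \<ge> 1 \<Longrightarrow> AE \<omega> in P. \<bar>Y n \<omega>\<bar> \<le> 1"
begin

abbreviation sq :: "nat \<Rightarrow> 'w \<Rightarrow> real" where
  "sq j \<omega> \<equiv> cond_sq P F Y j \<omega>"

abbreviation res :: "real \<Rightarrow> nat \<Rightarrow> 'w \<Rightarrow> ('a \<Rightarrow>\<^sub>L 'a)" where
  "res r n \<omega> \<equiv> resolv r (\<lambda>j. sq j \<omega>) (\<lambda>j. X j \<omega>) n"

lemma measurable_F_mono: "i \<le> j \<Longrightarrow> f \<in> borel_measurable (F i) \<Longrightarrow> f \<in> borel_measurable (F j)"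
  using filtration.sets_F_mono[OF filtration, of i j] filtration.space_F[OF filtration]
  by (auto simp: measurable_def)

lemma measurable_F_P: "f \<in> borel_measurable (F i) \<Longrightarrow> f \<in> borel_measurable P"
  by (rule measurable_from_subalg[OF subalgebra_F])

lemma norm_X: "n \<ge> 1 \<Longrightarrow> \<omega> \<in> space P \<Longrightarrow> norm (X n \<omega>) \<le> 1"
  using X_ball[of n \<omega>] by simp

lemma sq_meas: "sq j \<in> borel_measurable (F (j - 1))"
  unfolding cond_sq_def by measurable

lemma Y_meas_P: "n \<ge> 1 \<Longrightarrow> Y n \<in> borel_measurable P"
  by (rule measurable_F_P[OF Y_meas])

text \<open>\<open>real_cond_exp\<close> subtracts the conditional expectation of the negative part,
  which is zero for a square.\<close>

lemma real_cond_exp_sq: "AE \<omega> in P. real_cond_exp P (F (j - 1)) (\<lambda>\<omega>. (Y j \<omega>)\<^sup>2) \<omega> = sq j \<omega>"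
proof -
  interpret G: finite_measure_subalgebra P "F (j - 1)" by unfold_locales (rule subalgebra_F)
  have "AE \<omega> in P. 0 = nn_cond_exp P (F (j - 1)) (\<lambda>_. 0) \<omega>"
    by (rule G.nn_cond_exp_F_meas) simp
  then show ?thesis
    unfolding real_cond_exp_def cond_sq_def by eventually_elim (simp add: ennreal_neg)
qed

lemma sq_le_1:
  assumes "j \<ge> 1"
  shows "AE \<omega> in P. sq j \<omega> \<le> 1"
proof -
  interpret G: finite_measure_subalgebra P "F (j - 1)" by unfold_locales (rule subalgebra_F)
  have [measurable]: "Y j \<in> borel_measurable P" by (rule Y_meas_P[OF assms])
  have "AE \<omega> in P. nn_cond_exp P (F (j - 1)) (\<lambda>\<omega>. ennreal ((Y j \<omega>)\<^sup>2)) \<omega> \<le> nn_cond_exp P (F (j - 1)) (\<lambda>_. 1) \<omega>"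
  proof (rule G.nn_cond_exp_mono)
    show "AE \<omega> in P. ennreal ((Y j \<omega>)\<^sup>2) \<le> 1"
      using Y_bound[OF assms] by eventually_elim (simp add: abs_square_le_1 ennreal_le_1)
  qed measurable
  moreover have "AE \<omega> in P. 1 = nn_cond_exp P (F (j - 1)) (\<lambda>_. 1) \<omega>"
    by (rule G.nn_cond_exp_F_meas) simp
  ultimately show ?thesis
  proof eventually_elim
    case (elim \<omega>)
    then have "nn_cond_exp P (F (j - 1)) (\<lambda>\<omega>. ennreal ((Y j \<omega>)\<^sup>2)) \<omega> \<le> 1" by simp
    then show ?case unfolding cond_sq_def by (metis enn2real_leI ennreal_1 zero_le_one)
  qed
qed

lemma M_sum_meas: "M_sum X Y n \<in> borel_measurable (F n)"
  unfolding M_sum_def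
proof (intro borel_measurable_sum borel_measurable_scaleR)
  fix j assume j: "j \<in> {1..n}"
  show "Y j \<in> borel_measurable (F n)" by (rule measurable_F_mono[of j]) (use j Y_meas in auto)
  show "X j \<in> borel_measurable (F n)" by (rule measurable_F_mono[of "j - 1"]) (use j X_meas in auto)
qed

text \<open>The resolvent at time n involves only X_j and conditional variances with j <= n, all
  known at time n - 1; hence the range up to \<open>Suc k\<close>.\<close>

lemma res_meas:
  assumes "n \<le> Suc k" "\<rho> \<in> borel_measurable (F k)" "u \<in> borel_measurable (F k)"
  shows "(\<lambda>\<omega>. blinfun_apply (res (\<rho> \<omega>) n \<omega>) (u \<omega>)) \<in> borel_measurable (F k)"
proof (rule borel_measurable_resolv[OF _ _ assms(2,3)])
  fix j assume j: "1 \<le> j" "j \<le> n"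
  show "X j \<in> borel_measurable (F k)"
    by (rule measurable_F_mono[of "j - 1"]) (use j assms X_meas in auto)
  show "sq j \<in> borel_measurable (F k)"
    by (rule measurable_F_mono[of "j - 1"]) (use j assms sq_meas in auto)
qed

text \<open>\<open>Z_star\<close> is rewritten as the root of a quadratic form of the resolvent,
  which is measurable by recursion even at the random level \<open>gamma_star\<close>.\<close>

lemma Z_star_meas: "Z_star P F X Y n \<in> borel_measurable P"
  and gamma_star_meas: "gamma_star X n \<in> borel_measurable P"
proof -
  have X_P: "X j \<in> borel_measurable P" if "1 \<le> j" for j
    by (rule measurable_F_P[OF X_meas[OF that]])
  show g[measurable]: "gamma_star X n \<in> borel_measurable P"
    using X_P norm_X by (intro borel_measurable_gamma_star)
  have [measurable]: "M_sum X Y n \<in> borel_measurable P"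
    by (rule measurable_F_P[OF M_sum_meas])
  have [measurable]: "(\<lambda>\<omega>. blinfun_apply (res (gamma_star X n \<omega>) n \<omega>) (M_sum X Y n \<omega>)) \<in> borel_measurable P"
    by (intro borel_measurable_resolv X_P measurable_F_P[OF sq_meas]) auto
  have "Z_star P F X Y n \<omega> = sqrt (M_sum X Y n \<omega> \<bullet>
      blinfun_apply (res (gamma_star X n \<omega>) n \<omega>) (M_sum X Y n \<omega>))" if "\<omega> \<in> space P" for \<omega>
  proof -
    have "0 < gamma_star X n \<omega>" using gamma_star_ge_1[of n X \<omega>] norm_X[OF _ that] by fastforce
    from Z_norm_sq[OF this, of P F X Y n \<omega>] show ?thesis
      unfolding Z_star_def by (metis Z_norm_def norm_ge_zero real_sqrt_abs abs_of_nonneg)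
  qed
  then show "Z_star P F X Y n \<in> borel_measurable P"
    by (subst measurable_cong) measurable
qed

end

section \<open>The stopped exponential supermartingale\<close>

context self_normalized_martingale
begin

definition Z_sq :: "real \<Rightarrow> nat \<Rightarrow> 'w \<Rightarrow> real" where
  "Z_sq r n \<omega> = M_sum X Y n \<omega> \<bullet> blinfun_apply (res r n \<omega>) (M_sum X Y n \<omega>)"

definition wgt :: "real \<Rightarrow> nat \<Rightarrow> 'w \<Rightarrow> real" where
  "wgt r n \<omega> = X (Suc n) \<omega> \<bullet> blinfun_apply (res r n \<omega>) (X (Suc n) \<omega>)"

definition drift :: "real \<Rightarrow> nat \<Rightarrow> 'w \<Rightarrow> real" where
  "drift r n \<omega> = X (Suc n) \<omega> \<bullet> blinfun_apply (res r n \<omega>) (M_sum X Y n \<omega>)"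

text \<open>Decided by time n, so it can switch the step from n to n + 1 on or off
  predictably.\<close>

definition active :: "real \<Rightarrow> real \<Rightarrow> nat \<Rightarrow> 'w \<Rightarrow> bool" where
  "active r K n \<omega> \<longleftrightarrow> (\<forall>i\<le>n. Z_sq r i \<omega> \<le> K\<^sup>2)"

definition incr :: "real \<Rightarrow> real \<Rightarrow> nat \<Rightarrow> 'w \<Rightarrow> real" where
  "incr r \<eta> n \<omega> = \<eta> * ((2 * Y (Suc n) \<omega> * drift r n \<omega> - sq (Suc n) \<omega> * (drift r n \<omega>)\<^sup>2
      + (Y (Suc n) \<omega>)\<^sup>2 * wgt r n \<omega>) / (1 + sq (Suc n) \<omega> * wgt r n \<omega>))
    - 9 / 8 * \<eta> * ln (1 + sq (Suc n) \<omega> * wgt r n \<omega>)"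

text \<open>The step at which Z first exceeds K is still counted, so the process freezes just after
  the crossing.\<close>

definition supermart :: "real \<Rightarrow> real \<Rightarrow> real \<Rightarrow> nat \<Rightarrow> 'w \<Rightarrow> real" where
  "supermart r K \<eta> n \<omega> = exp (\<Sum>i<n. if active r K i \<omega> then incr r \<eta> i \<omega> else 0)"

lemma Y_bound_Suc: "AE \<omega> in P. \<bar>Y (Suc n) \<omega>\<bar> \<le> 1"
  using Y_bound[of "Suc n"] by simp

lemma Z_sq_0: "Z_sq r 0 \<omega> = 0"
  by (simp add: Z_sq_def M_sum_def)

lemma Z_sq_nonneg: "0 < r \<Longrightarrow> 0 \<le> Z_sq r n \<omega>"
  unfolding Z_sq_def by (rule resolv_form_nonneg[OF cond_sq_nonneg])

lemma Z_sq_Suc: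
  assumes "0 < r"
  shows "Z_sq r (Suc n) \<omega> = Z_sq r n \<omega> +
    (2 * Y (Suc n) \<omega> * drift r n \<omega> - sq (Suc n) \<omega> * (drift r n \<omega>)\<^sup>2
      + (Y (Suc n) \<omega>)\<^sup>2 * wgt r n \<omega>) / (1 + sq (Suc n) \<omega> * wgt r n \<omega>)"
proof -
  have "M_sum X Y (Suc n) \<omega> = M_sum X Y n \<omega> + Y (Suc n) \<omega> *\<^sub>R X (Suc n) \<omega>"
    by (simp add: M_sum_def)
  then show ?thesis
    using resolv_form_Suc[of "\<lambda>j. sq j \<omega>" r "M_sum X Y n \<omega>" "Y (Suc n) \<omega>" "\<lambda>j. X j \<omega>" n,
        OF cond_sq_nonneg assms]
    unfolding Z_sq_def wgt_def drift_def by (simp only:)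
qed

lemma wgt_nonneg: "0 < r \<Longrightarrow> 0 \<le> wgt r n \<omega>"
  unfolding wgt_def by (rule resolv_form_nonneg[OF cond_sq_nonneg])

lemma wgt_le:
  assumes "0 < r" "\<omega> \<in> space P"
  shows "wgt r n \<omega> \<le> 1 / r"
proof -
  have "wgt r n \<omega> \<le> (norm (X (Suc n) \<omega>))\<^sup>2 / r"
    unfolding wgt_def by (rule resolv_form_le[OF cond_sq_nonneg assms(1)])
  also have "\<dots> \<le> 1 / r"
    using norm_X[of "Suc n" \<omega>] assms by (intro divide_right_mono) (auto simp: power_le_one)
  finally show ?thesis .
qed

lemma drift_sq_le: "0 < r \<Longrightarrow> (drift r n \<omega>)\<^sup>2 \<le> wgt r n \<omega> * Z_sq r n \<omega>"
  using positive_op_Cauchy_Schwarz[OF positive_op_resolv[of "\<lambda>j. sq j \<omega>" r, OF cond_sq_nonneg],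
      of "\<lambda>j. X j \<omega>" n "M_sum X Y n \<omega>" "X (Suc n) \<omega>"]
  unfolding drift_def wgt_def Z_sq_def by (simp add: inner_commute mult.commute)

lemma abs_drift_le:
  assumes r: "0 < r" and K: "0 \<le> K" and \<omega>: "\<omega> \<in> space P" and act: "active r K n \<omega>"
  shows "\<bar>drift r n \<omega>\<bar> \<le> K / sqrt r"
proof -
  have "(drift r n \<omega>)\<^sup>2 \<le> wgt r n \<omega> * Z_sq r n \<omega>" by (rule drift_sq_le[OF r])
  also have "\<dots> \<le> 1 / r * K\<^sup>2"
    using wgt_le[OF r \<omega>, of n] act Z_sq_nonneg[OF r, of n \<omega>] r
    unfolding active_def by (intro mult_mono) auto
  also have "\<dots> = (K / sqrt r)\<^sup>2" using r by (simp add: power_divide)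
  finally show ?thesis using K r by (simp add: abs_le_square_iff[symmetric])
qed

lemma wgt_meas: "wgt r n \<in> borel_measurable (F n)"
  unfolding wgt_def using X_meas[of "Suc n"] by (intro borel_measurable_inner res_meas) auto

lemma drift_meas: "drift r n \<in> borel_measurable (F n)"
  unfolding drift_def using X_meas[of "Suc n"] M_sum_meas
  by (intro borel_measurable_inner res_meas) auto

lemma Z_sq_meas: "Z_sq r n \<in> borel_measurable (F n)"
  unfolding Z_sq_def using M_sum_meas by (intro borel_measurable_inner res_meas) auto

lemma active_meas: "Measurable.pred (F n) (active r K n)"
proof -
  have [measurable]: "Z_sq r i \<in> borel_measurable (F n)" if "i \<le> n" for i
    using that Z_sq_meas measurable_F_mono by blast
  show ?thesis unfolding active_def by measurable
qed

lemma sq_Suc_meas: "sq (Suc n) \<in> borel_measurable (F n)"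
  using sq_meas[of "Suc n"] by simp

lemma incr_meas: "incr r \<eta> n \<in> borel_measurable (F (Suc n))"
proof -
  have [measurable]: "wgt r n \<in> borel_measurable (F (Suc n))" "drift r n \<in> borel_measurable (F (Suc n))"
    "sq (Suc n) \<in> borel_measurable (F (Suc n))" "Y (Suc n) \<in> borel_measurable (F (Suc n))"
    by (intro measurable_F_mono[of n "Suc n"] wgt_meas drift_meas sq_Suc_meas; simp)+
      (simp add: Y_meas)
  show ?thesis unfolding incr_def by measurable
qed

lemma supermart_meas: "supermart r K \<eta> n \<in> borel_measurable (F n)"
proof -
  have "(\<lambda>\<omega>. if active r K i \<omega> then incr r \<eta> i \<omega> else 0) \<in> borel_measurable (F n)" if "i < n" for i
  proof -
    have [measurable]: "incr r \<eta> i \<in> borel_measurable (F n)"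
      using measurable_F_mono[OF _ incr_meas] that by simp
    \<comment> \<open>The predicate is passed through its indicator because
      \<open>measurable_F_mono\<close> speaks of \<open>borel_measurable\<close> functions.\<close>
    have "(\<lambda>\<omega>. if active r K i \<omega> then 1 else (0::real)) \<in> borel_measurable (F i)"
      using active_meas[where r = r and K = K and n = i] by measurable
    then have [measurable]: "(\<lambda>\<omega>. if active r K i \<omega> then 1 else (0::real)) \<in> borel_measurable (F n)"
      using measurable_F_mono that by (metis less_imp_le)
    have "(\<lambda>\<omega>. (if active r K i \<omega> then 1 else 0) * incr r \<eta> i \<omega>) \<in> borel_measurable (F n)"
      by measurable
    then show ?thesis by (simp add: if_distrib[of "\<lambda>a. a * _"] cong: if_cong)
  qed
  then show ?thesis unfolding supermart_def
    by (intro borel_measurable_exp[THEN measurable_compose_rev] borel_measurable_sum) auto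
qed

lemma supermart_Suc:
  "supermart r K \<eta> (Suc n) \<omega> = supermart r K \<eta> n \<omega> *
     (if active r K n \<omega> then exp (incr r \<eta> n \<omega>) else 1)"
  unfolding supermart_def by (simp add: exp_add)

text \<open>\<open>r\<close> at least 2 makes w at most 1/2; \<open>small\<close> keeps the random
  part of the exponent of an active step within [-1, 1], since then |a| <= K / sqrt r and w <= 1 /
  r.\<close>

context
  fixes r K \<eta> :: real
  assumes r: "2 \<le> r" and K: "0 \<le> K" and \<eta>: "0 < \<eta>" "\<eta> \<le> 1 / 8"
    and small: "\<eta> * (2 * (K / sqrt r) + 1 / r) \<le> 1"
begin

abbreviation "S \<equiv> supermart r K \<eta>"

text \<open>This and the next three definitions turn b, U, \<alpha>, \<beta> of the one-step
  estimate into processes; the inactive values 1, 0, 0 of the last three reduce that estimate to 1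
  <= 1.\<close>

definition bfac :: "nat \<Rightarrow> 'w \<Rightarrow> real" where
  "bfac n \<omega> = 1 / (1 + sq (Suc n) \<omega> * wgt r n \<omega>)"

definition Ufac :: "nat \<Rightarrow> 'w \<Rightarrow> real" where
  "Ufac n \<omega> = (if active r K n \<omega> then exp (- (\<eta> * bfac n \<omega> * sq (Suc n) \<omega> * (drift r n \<omega>)\<^sup>2)
     - 9 / 8 * \<eta> * ln (1 + sq (Suc n) \<omega> * wgt r n \<omega>)) else 1)"

definition lin_coeff :: "nat \<Rightarrow> 'w \<Rightarrow> real" where
  "lin_coeff n \<omega> = (if active r K n \<omega> then 2 * \<eta> * bfac n \<omega> * drift r n \<omega> else 0)"

definition quad_coeff :: "nat \<Rightarrow> 'w \<Rightarrow> real" where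
  "quad_coeff n \<omega> = (if active r K n \<omega> then \<eta> * bfac n \<omega> * wgt r n \<omega> +
     \<eta>\<^sup>2 * (bfac n \<omega>)\<^sup>2 * (8 * (drift r n \<omega>)\<^sup>2 + 2 * (wgt r n \<omega>)\<^sup>2) else 0)"

lemma coeff_meas:
  "Ufac n \<in> borel_measurable (F n)" "lin_coeff n \<in> borel_measurable (F n)"
  "quad_coeff n \<in> borel_measurable (F n)"
proof -
  note [measurable] = wgt_meas drift_meas sq_Suc_meas active_meas
  show "Ufac n \<in> borel_measurable (F n)" "lin_coeff n \<in> borel_measurable (F n)"
    "quad_coeff n \<in> borel_measurable (F n)"
    unfolding Ufac_def lin_coeff_def quad_coeff_def bfac_def by measurable
qed

lemma step_hyps:
  assumes "\<omega> \<in> space P" "active r K n \<omega>"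
  shows "0 \<le> wgt r n \<omega>" "wgt r n \<omega> \<le> 1 / 2" "\<eta> * (2 * \<bar>drift r n \<omega>\<bar> + wgt r n \<omega>) \<le> 1"
proof -
  have r0: "0 < r" using r by simp
  show "0 \<le> wgt r n \<omega>" using wgt_nonneg[OF r0] .
  have w: "wgt r n \<omega> \<le> 1 / r" by (rule wgt_le[OF r0 assms(1)])
  also have "\<dots> \<le> 1 / 2" using r by (simp add: field_simps)
  finally show "wgt r n \<omega> \<le> 1 / 2" .
  have "\<eta> * (2 * \<bar>drift r n \<omega>\<bar> + wgt r n \<omega>) \<le> \<eta> * (2 * (K / sqrt r) + 1 / r)"
    using abs_drift_le[OF r0 K assms] w \<eta> by (intro mult_left_mono add_mono) auto
  then show "\<eta> * (2 * \<bar>drift r n \<omega>\<bar> + wgt r n \<omega>) \<le> 1" using small by simp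
qed

lemma coeff_facts:
  assumes "\<omega> \<in> space P"
  shows "0 < Ufac n \<omega>" "Ufac n \<omega> \<le> 1" "\<bar>lin_coeff n \<omega>\<bar> \<le> 1" "0 \<le> quad_coeff n \<omega>" "quad_coeff n \<omega> \<le> 5"
    "Ufac n \<omega> * (1 + quad_coeff n \<omega> * sq (Suc n) \<omega>) \<le> 1"
  using discount_bounds[OF cond_sq_nonneg step_hyps(1,2) \<eta> step_hyps(3), OF assms _ assms _ assms]
    coeff_bounds[OF cond_sq_nonneg step_hyps(1,2) \<eta> step_hyps(3), OF assms _ assms _ assms]
    compensated_le_1[OF cond_sq_nonneg step_hyps(1,2) \<eta> step_hyps(3), OF assms _ assms _ assms]
  unfolding Ufac_def lin_coeff_def quad_coeff_def bfac_def by auto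

lemma step_le:
  assumes "\<omega> \<in> space P" "\<bar>Y (Suc n) \<omega>\<bar> \<le> 1"
  shows "(if active r K n \<omega> then exp (incr r \<eta> n \<omega>) else 1)
    \<le> Ufac n \<omega> * (1 + lin_coeff n \<omega> * Y (Suc n) \<omega> + quad_coeff n \<omega> * (Y (Suc n) \<omega>)\<^sup>2)"
  using exp_increment_le[OF cond_sq_nonneg step_hyps(1,2) \<eta> step_hyps(3) assms(2), OF assms(1) _ assms(1) _ assms(1)]
  unfolding Ufac_def lin_coeff_def quad_coeff_def bfac_def incr_def by auto

text \<open>Growth in n is harmless, as the bound serves integrability only; 7 = 1 + 1 + 5 bounds
  the quadratic when |Y| <= 1.\<close>

lemma supermart_le: "AE \<omega> in P. S n \<omega> \<le> 7 ^ n"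
proof (induction n)
  case 0
  show ?case by (simp add: supermart_def)
next
  case (Suc n)
  from Suc Y_bound_Suc[of n] AE_space show ?case
  proof (eventually_elim)
    case (elim \<omega>)
    have Y: "\<bar>Y (Suc n) \<omega>\<bar> \<le> 1" using elim by simp
    then have Y2: "(Y (Suc n) \<omega>)\<^sup>2 \<le> 1" by (simp add: abs_square_le_1)
    note cf = coeff_facts[OF elim(3), of n]
    have "\<bar>lin_coeff n \<omega>\<bar> * \<bar>Y (Suc n) \<omega>\<bar> \<le> 1 * 1" using cf Y by (intro mult_mono) auto
    then have 1: "lin_coeff n \<omega> * Y (Suc n) \<omega> \<le> 1" by (simp add: abs_mult[symmetric])
    have 2: "quad_coeff n \<omega> * (Y (Suc n) \<omega>)\<^sup>2 \<le> 5 * 1" using cf Y2 by (intro mult_mono) auto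
    have "Ufac n \<omega> * (1 + lin_coeff n \<omega> * Y (Suc n) \<omega> + quad_coeff n \<omega> * (Y (Suc n) \<omega>)\<^sup>2) \<le> Ufac n \<omega> * 7"
      using cf 1 2 by (intro mult_left_mono) auto
    also have "\<dots> \<le> 7" using cf by simp
    finally have "(if active r K n \<omega> then exp (incr r \<eta> n \<omega>) else 1) \<le> 7"
      using step_le[OF elim(3) Y] by linarith
    then have "S (Suc n) \<omega> \<le> 7 ^ n * 7"
      unfolding supermart_Suc using elim(1) by (intro mult_mono) auto
    then show ?case by simp
  qed
qed

lemma supermart_integrable: "integrable P (S n)"
  using supermart_le[of n] measurable_F_P[OF supermart_meas]
  by (intro integrable_const_bound[of _ "7 ^ n"]) (auto simp: supermart_def)

text \<open>The factors beside Y and Y^2 are known at time n, so conditional moments may be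
  inserted; the one-step bound U (1 + \<beta> s) <= 1 then closes the induction.\<close>

lemma supermart_expectation_le: "expectation (S n) \<le> 1"
proof (induction n)
  case 0
  show ?case by (simp add: supermart_def prob_space)
next
  case (Suc n)
  define H0 H1 H2 where "H0 \<omega> = S n \<omega> * Ufac n \<omega>" and "H1 \<omega> = S n \<omega> * Ufac n \<omega> * lin_coeff n \<omega>"
    and "H2 \<omega> = S n \<omega> * Ufac n \<omega> * quad_coeff n \<omega>" for \<omega>
  have S_pos: "0 < S n \<omega>" for \<omega> unfolding supermart_def by simp
  have H_meas: "H0 \<in> borel_measurable (F n)" "H1 \<in> borel_measurable (F n)" "H2 \<in> borel_measurable (F n)"
    unfolding H0_def H1_def H2_def
    by (intro borel_measurable_times coeff_meas supermart_meas)+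
  have bd: "AE \<omega> in P. \<bar>H0 \<omega>\<bar> \<le> 7 ^ n * 5 \<and> \<bar>H1 \<omega>\<bar> \<le> 7 ^ n * 5 \<and> \<bar>H2 \<omega>\<bar> \<le> 7 ^ n * 5"
    using supermart_le[of n] AE_space
  proof eventually_elim
    case (elim \<omega>)
    note cf = coeff_facts[OF elim(2), of n]
    have "S n \<omega> * Ufac n \<omega> \<le> 7 ^ n * 1" using elim(1) cf S_pos[of \<omega>] by (intro mult_mono) auto
    then have H0: "\<bar>H0 \<omega>\<bar> \<le> 7 ^ n" unfolding H0_def using cf S_pos[of \<omega>] by (simp add: abs_mult)
    have "\<bar>H0 \<omega>\<bar> * \<bar>lin_coeff n \<omega>\<bar> \<le> 7 ^ n * 1" using H0 cf by (intro mult_mono) auto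
    moreover have "\<bar>H0 \<omega>\<bar> * \<bar>quad_coeff n \<omega>\<bar> \<le> 7 ^ n * 5" using H0 cf by (intro mult_mono) auto
    moreover have "\<bar>H1 \<omega>\<bar> = \<bar>H0 \<omega>\<bar> * \<bar>lin_coeff n \<omega>\<bar>" "\<bar>H2 \<omega>\<bar> = \<bar>H0 \<omega>\<bar> * \<bar>quad_coeff n \<omega>\<bar>"
      unfolding H0_def H1_def H2_def by (simp_all add: abs_mult)
    moreover have "(7::real) ^ n \<le> 7 ^ n * 5" by simp
    ultimately show ?case using H0 by linarith
  qed
  have "AE \<omega> in P. real_cond_exp P (F n) (Y (Suc n)) \<omega> = 0" using Y_mean[of "Suc n"] by simp
  moreover have "AE \<omega> in P. real_cond_exp P (F n) (\<lambda>\<omega>. (Y (Suc n) \<omega>)\<^sup>2) \<omega> = sq (Suc n) \<omega>"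
    using real_cond_exp_sq[of "Suc n"] by simp
  moreover have "AE \<omega> in P. \<bar>H0 \<omega>\<bar> \<le> 7 ^ n * 5" "AE \<omega> in P. \<bar>H1 \<omega>\<bar> \<le> 7 ^ n * 5"
    "AE \<omega> in P. \<bar>H2 \<omega>\<bar> \<le> 7 ^ n * 5" using bd by auto
  ultimately have int:
    "integrable P (\<lambda>\<omega>. H0 \<omega> + H1 \<omega> * Y (Suc n) \<omega> + H2 \<omega> * (Y (Suc n) \<omega>)\<^sup>2)"
    "integrable P (\<lambda>\<omega>. H0 \<omega> + H2 \<omega> * sq (Suc n) \<omega>)"
    "(\<integral>\<omega>. H0 \<omega> + H1 \<omega> * Y (Suc n) \<omega> + H2 \<omega> * (Y (Suc n) \<omega>)\<^sup>2 \<partial>P) = (\<integral>\<omega>. H0 \<omega> + H2 \<omega> * sq (Suc n) \<omega> \<partial>P)"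
    using expectation_quadratic_increment[OF subalgebra_F[of n] Y_meas_P[of "Suc n"] Y_bound[of "Suc n"],
        of "sq (Suc n)" H0 H1 H2 "7 ^ n * 5"] H_meas measurable_F_P[OF sq_meas[of "Suc n"]] by auto
  have "expectation (S (Suc n)) \<le> (\<integral>\<omega>. H0 \<omega> + H1 \<omega> * Y (Suc n) \<omega> + H2 \<omega> * (Y (Suc n) \<omega>)\<^sup>2 \<partial>P)"
  proof (rule integral_mono_AE[OF supermart_integrable int(1)])
    from Y_bound_Suc[of n] AE_space
    show "AE \<omega> in P. S (Suc n) \<omega> \<le> H0 \<omega> + H1 \<omega> * Y (Suc n) \<omega> + H2 \<omega> * (Y (Suc n) \<omega>)\<^sup>2"
    proof eventually_elim
      case (elim \<omega>)
      have "S (Suc n) \<omega> \<le> S n \<omega> * (Ufac n \<omega> * (1 + lin_coeff n \<omega> * Y (Suc n) \<omega>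
          + quad_coeff n \<omega> * (Y (Suc n) \<omega>)\<^sup>2))"
        unfolding supermart_Suc using S_pos[of \<omega>] elim step_le[of \<omega> n]
        by (intro mult_left_mono) auto
      then show ?case unfolding H0_def H1_def H2_def by (simp add: algebra_simps)
    qed
  qed
  also have "\<dots> = (\<integral>\<omega>. H0 \<omega> + H2 \<omega> * sq (Suc n) \<omega> \<partial>P)" by (rule int(3))
  also have "\<dots> \<le> expectation (S n)"
  proof (rule integral_mono[OF int(2) supermart_integrable])
    fix \<omega> assume "\<omega> \<in> space P"
    then have "S n \<omega> * (Ufac n \<omega> * (1 + quad_coeff n \<omega> * sq (Suc n) \<omega>)) \<le> S n \<omega> * 1"
      using coeff_facts(6)[of \<omega> n] S_pos[of \<omega>] by (intro mult_left_mono) auto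
    then show "H0 \<omega> + H2 \<omega> * sq (Suc n) \<omega> \<le> S n \<omega>"
      unfolding H0_def H2_def by (simp add: algebra_simps)
  qed
  finally show ?case using Suc by simp
qed

end

end

section \<open>Crossing probabilities and stitching\<close>

text \<open>\<open>q\<close> bounds the unscaled increment, so min (1/8) (1/q) is the largest rate
  allowed. The term 9/4 r is 9/8 times the compensator bound 2 r; the exponent 2 L, rather than L,
  makes the union bound summable.\<close>

lemma threshold_exponent:
  fixes r L :: real
  assumes r: "2 \<le> r" and L: "0 < L"
  defines "K \<equiv> 70 * (sqrt (r / 2 + L) + L / sqrt r)"
  shows "\<exists>\<eta>>0. \<eta> \<le> 1 / 8 \<and> \<eta> * (2 * (K / sqrt r) + 1 / r) \<le> 1 \<and> 2 * L \<le> \<eta> * (K\<^sup>2 - 9 / 4 * r)"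
proof -
  define q where "q = 2 * (K / sqrt r) + 1 / r"
  define g where "g = sqrt (r / 2 + L)"
  define h where "h = L / sqrt r"
  have g: "0 < g" "g\<^sup>2 = r / 2 + L" unfolding g_def using r L by auto
  have h: "0 < h" unfolding h_def using r L by simp
  have K_gh: "K = 70 * (g + h)" unfolding K_def g_def h_def ..
  have K0: "0 < K" unfolding K_gh using g h by simp
  have q: "0 < q" unfolding q_def using K0 r by (simp add: add_pos_pos)
  have "(70 * g)\<^sup>2 \<le> K\<^sup>2" unfolding K_gh using g h by (intro power_mono) auto
  then have K1: "4900 * (r / 2 + L) \<le> K\<^sup>2" by (simp add: power_mult_distrib g(2))
  have "70 * h * K \<le> K * K" using K_gh g h K0 by (intro mult_right_mono) auto
  then have K2: "70 * (K * h) \<le> K\<^sup>2" by (simp add: power2_eq_square mult_ac)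
  have L_r: "L / r \<le> L" using r L by (simp add: field_simps)
  show ?thesis
  proof (cases "q \<le> 8")
    case True
    show ?thesis
      \<comment> \<open>Here K^2 >= 4900 (r / 2 + L) exceeds 16 L + 9/4 r.\<close>
      by (intro exI[of _ "1 / 8"]) (use True K1 r L in \<open>simp add: q_def\<close>)
  next
    case False
    \<comment> \<open>2 L / \<eta> now contains the product K h, which is covered by K >= 70 h, the
      linear part of the threshold.\<close>
    have "2 * L * q = 4 * (K * h) + 2 * (L / r)"
      unfolding q_def h_def by (simp add: algebra_simps)
    also have "\<dots> \<le> K\<^sup>2 - 9 / 4 * r"
    proof -
      have "4 * a + 2 * l \<le> k - 9 / 4 * r"
        if "4900 * (r / 2 + L) \<le> k" "70 * a \<le> k" "l \<le> L" for a l k :: real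
      proof -
        have "2450 * r + 4900 * L \<le> k" "0 < r" using that(1) r by (simp_all add: distrib_left)
        then show ?thesis using that(2,3) L by linarith
      qed
      then show ?thesis using K1 K2 L_r by blast
    qed
    finally have "2 * L \<le> 1 / q * (K\<^sup>2 - 9 / 4 * r)" using q by (simp add: field_simps)
    moreover have "1 / q \<le> 1 / 8" using False by (simp add: field_simps)
    ultimately show ?thesis
      unfolding q_def[symmetric] using q by (intro exI[of _ "1 / q"]) auto
  qed
qed

lemma dyadic_interval:
  fixes x :: real
  assumes "1 \<le> x"
  shows "\<exists>k. 2 ^ k \<le> x \<and> x < 2 ^ Suc k"
proof -
  obtain m where m: "x < 2 ^ m" using real_arch_pow[of 2 x] by auto
  define k where "k = (LEAST k. x < 2 ^ Suc k)"
  have "x < 2 ^ Suc m" using m by (simp add: less_trans)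
  then have 1: "x < 2 ^ Suc k" unfolding k_def by (rule LeastI)
  have "2 ^ k \<le> x"
  proof (cases k)
    case 0
    then show ?thesis using assms by simp
  next
    case (Suc i)
    then have "\<not> x < 2 ^ Suc i" using not_less_Least[of i "\<lambda>k. x < 2 ^ Suc k"] unfolding k_def by simp
    then show ?thesis using Suc by simp
  qed
  with 1 show ?thesis by blast
qed

text \<open>As ln 4 >= 1, the hypothesis gives 1 + k <= ln (e n); one more logarithm yields the cost
  of level k.\<close>

lemma iota_ge:
  assumes "4 ^ k \<le> n"
  shows "1 + ln (1 + real k) \<le> iota n"
proof -
  have n: "1 \<le> n" using assms by (metis le_trans one_le_numeral one_le_power)
  have "real k \<le> real k * ln 4"
  proof -
    have "1 \<le> ln (4 :: real)" using exp_le by (simp add: ln_ge_iff)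
    then show ?thesis by (simp add: mult_le_cancel_left1)
  qed
  also have "\<dots> = ln (4 ^ k)" by (simp add: ln_realpow)
  also have "\<dots> \<le> ln (real n)"
  proof -
    have "(4::real) ^ k \<le> real n" using assms by (metis of_nat_le_iff of_nat_numeral of_nat_power)
    then show ?thesis by (intro ln_mono) auto
  qed
  finally have "1 + real k \<le> ln (exp 1 * real n)" using n by (simp add: ln_mult)
  then show ?thesis unfolding iota_def by (simp add: ln_mono)
qed

context self_normalized_martingale
begin

text \<open>Up to the first crossing time m <= n the active steps telescope. The gain is controlled
  at \<open>n\<close>, but it grows with the length, so the compensator at \<open>m\<close> is
  controlled too.\<close>

lemma supermart_crossing:
  assumes r: "0 < r" and \<eta>: "0 < \<eta>" and sq1: "\<And>j. 1 \<le> j \<Longrightarrow> sq j \<omega> \<le> 1" and n: "n \<le> N"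
    and cross: "K\<^sup>2 < Z_sq r n \<omega>" and gain: "info_gain (inverse r *\<^sub>R V_op X n \<omega>) \<le> r"
  shows "exp (\<eta> * (K\<^sup>2 - 9 / 4 * r)) \<le> supermart r K \<eta> N \<omega>"
proof -
  define m where "m = (LEAST m. K\<^sup>2 < Z_sq r m \<omega>)"
  have m: "K\<^sup>2 < Z_sq r m \<omega>" unfolding m_def using cross by (rule LeastI)
  have mn: "m \<le> n" unfolding m_def using cross by (rule Least_le)
  have active_iff: "active r K i \<omega> \<longleftrightarrow> i < m" for i
    unfolding active_def
  proof
    assume "\<forall>j\<le>i. Z_sq r j \<omega> \<le> K\<^sup>2"
    then show "i < m" using m by (meson not_le)
  next
    assume "i < m"
    then show "\<forall>j\<le>i. Z_sq r j \<omega> \<le> K\<^sup>2"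
      using not_less_Least[of _ "\<lambda>m. K\<^sup>2 < Z_sq r m \<omega>"] unfolding m_def[symmetric] by (meson le_less_trans not_le)
  qed
  have sum_incr: "(\<Sum>i<k. incr r \<eta> i \<omega>) = \<eta> * Z_sq r k \<omega>
      - 9 / 8 * \<eta> * (\<Sum>i<k. ln (1 + sq (Suc i) \<omega> * wgt r i \<omega>))" for k
  proof (induction k)
    case 0
    show ?case by (simp add: Z_sq_0)
  next
    case (Suc k)
    then show ?case unfolding Z_sq_Suc[OF r] by (simp add: incr_def algebra_simps)
  qed
  have "(\<Sum>i<m. ln (1 + sq (Suc i) \<omega> * wgt r i \<omega>))
      = (\<Sum>j=1..m. ln (1 + sq j \<omega> * (X j \<omega> \<bullet> blinfun_apply (res r (j - 1) \<omega>) (X j \<omega>))))"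
    unfolding wgt_def by (rule sum.reindex_bij_witness[of _ "\<lambda>j. j - 1" Suc]) auto
  also have "\<dots> \<le> 2 * info_gain (weighted_sum (\<lambda>_. 1 / r) (\<lambda>j. X j \<omega>) m)"
    by (rule sum_ln_resolv_form_le[OF cond_sq_nonneg sq1 r])
  also have "\<dots> \<le> 2 * info_gain (weighted_sum (\<lambda>_. 1 / r) (\<lambda>j. X j \<omega>) n)"
    using info_gain_weighted_sum_mono_length[of "\<lambda>_. 1 / r" m n "\<lambda>j. X j \<omega>"] r mn by simp
  also have "\<dots> \<le> 2 * r" using gain unfolding V_op_scale by simp
  finally have "9 / 8 * \<eta> * (\<Sum>i<m. ln (1 + sq (Suc i) \<omega> * wgt r i \<omega>)) \<le> 9 / 8 * \<eta> * (2 * r)"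
    using \<eta> by (intro mult_left_mono) auto
  moreover have "\<eta> * K\<^sup>2 \<le> \<eta> * Z_sq r m \<omega>" using m \<eta> by (intro mult_left_mono) auto
  ultimately have "\<eta> * (K\<^sup>2 - 9 / 4 * r) \<le> (\<Sum>i<m. incr r \<eta> i \<omega>)"
    unfolding sum_incr by (simp add: algebra_simps)
  \<comment> \<open>Frozen from m on, the process still carries at the deterministic time
    \<open>N\<close> the value reached at m.\<close>
  also have "\<dots> = (\<Sum>i<N. if active r K i \<omega> then incr r \<eta> i \<omega> else 0)"
    unfolding active_iff using mn n by (intro sum.mono_neutral_cong_left) auto
  finally show ?thesis unfolding supermart_def by simp
qed

text \<open>The gain condition is part of the event, as it bounds the compensator; the finite
  horizon lets Markov's inequality be applied at a deterministic time.\<close>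

definition crossing :: "real \<Rightarrow> real \<Rightarrow> nat \<Rightarrow> 'w set" where
  "crossing r K N = {\<omega> \<in> space P. \<exists>n\<in>{1..N}. K\<^sup>2 < Z_sq r n \<omega> \<and> info_gain (inverse r *\<^sub>R V_op X n \<omega>) \<le> r}"

lemma crossing_sets: "0 < r \<Longrightarrow> crossing r K N \<in> sets P"
proof -
  assume r: "0 < r"
  have [measurable]: "Z_sq r n \<in> borel_measurable P" for n by (rule measurable_F_P[OF Z_sq_meas])
  have [measurable]: "(\<lambda>\<omega>. info_gain (inverse r *\<^sub>R V_op X n \<omega>)) \<in> borel_measurable P" for n
    by (rule borel_measurable_info_gain_V_op[OF _ r]) (rule measurable_F_P[OF X_meas])
  show ?thesis unfolding crossing_def by measurable
qed

lemma prob_crossing_le: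
  assumes r: "2 \<le> r" and K: "0 \<le> K" and \<eta>: "0 < \<eta>" "\<eta> \<le> 1 / 8"
    and small: "\<eta> * (2 * (K / sqrt r) + 1 / r) \<le> 1"
  shows "prob (crossing r K N) \<le> exp (- (\<eta> * (K\<^sup>2 - 9 / 4 * r)))"
proof -
  define S where "S = supermart r K \<eta> N"
  define e where "e = exp (\<eta> * (K\<^sup>2 - 9 / 4 * r))"
  have int: "integrable P S" unfolding S_def by (rule supermart_integrable[OF assms])
  then have [measurable]: "S \<in> borel_measurable P" by simp
  have "AE \<omega> in P. \<forall>j. 1 \<le> j \<longrightarrow> sq j \<omega> \<le> 1"
    unfolding AE_all_countable using sq_le_1 by auto
  \<comment> \<open>The inclusion is only almost sure: conditional variances are at most 1 outside a
    null set.\<close>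
  then have "AE \<omega> in P. \<omega> \<in> crossing r K N \<longrightarrow> \<omega> \<in> {\<omega> \<in> space P. e \<le> S \<omega>}"
  proof eventually_elim
    case (elim \<omega>)
    show ?case
      using supermart_crossing[of r \<eta> \<omega> _ N K] elim r \<eta> unfolding crossing_def S_def e_def by auto
  qed
  then have "prob (crossing r K N) \<le> prob {\<omega> \<in> space P. e \<le> S \<omega>}"
    by (intro finite_measure_mono_AE) measurable
  also have "\<dots> \<le> expectation S / e"
    by (rule integral_Markov_inequality_measure[OF int, of "space P"])
      (auto simp: S_def supermart_def e_def)
  also have "\<dots> \<le> 1 / e"
    using supermart_expectation_le[OF assms, of N] unfolding S_def e_def
    by (intro divide_right_mono) auto
  finally show ?thesis unfolding e_def by (simp add: exp_minus inverse_eq_divide)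
qed

text \<open>The bound is uniform in the horizon and the events increase with it, so it passes to the
  limit.\<close>

lemma prob_crossing_ever_le:
  assumes r: "2 \<le> r" and L: "0 < L"
  defines "K \<equiv> 70 * (sqrt (r / 2 + L) + L / sqrt r)"
  shows "(\<Union>N. crossing r K N) \<in> sets P" "prob (\<Union>N. crossing r K N) \<le> exp (- (2 * L))"
proof -
  have sets: "crossing r K N \<in> sets P" for N using crossing_sets r by simp
  then show "(\<Union>N. crossing r K N) \<in> sets P" by blast
  have K: "0 \<le> K" unfolding K_def using r L by simp
  obtain \<eta> where \<eta>: "0 < \<eta>" "\<eta> \<le> 1 / 8" "\<eta> * (2 * (K / sqrt r) + 1 / r) \<le> 1"
    "2 * L \<le> \<eta> * (K\<^sup>2 - 9 / 4 * r)"
    using threshold_exponent[OF r L] unfolding K_def by blast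
  have "prob (crossing r K N) \<le> exp (- (2 * L))" for N
  proof -
    have "exp (- (\<eta> * (K\<^sup>2 - 9 / 4 * r))) \<le> exp (- (2 * L))" using \<eta>(4) by simp
    then show ?thesis using prob_crossing_le[OF r K \<eta>(1,2,3), of N] by linarith
  qed
  moreover have "(\<lambda>N. prob (crossing r K N)) \<longlonglongrightarrow> prob (\<Union>N. crossing r K N)"
    using sets by (intro finite_Lim_measure_incseq) (force simp: incseq_def crossing_def)+
  ultimately show "prob (\<Union>N. crossing r K N) \<le> exp (- (2 * L))"
    by (intro LIMSEQ_le_const2) auto
qed

section \<open>Union bound over dyadic levels\<close>

context
  fixes y :: real
  assumes y: "0 < y"
begin

text \<open>Chosen so that exp (-2 L) = exp (-2 y - 2) / (1 + k)^2 is summable in k, while L <= y +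
  iota n whenever 4^k <= n.\<close>

definition dev_level :: "nat \<Rightarrow> real" where
  "dev_level k = y + (1 + ln (1 + real k))"

definition dyadic_event :: "nat \<Rightarrow> 'w set" where
  "dyadic_event k = (\<Union>N. crossing (2 ^ Suc k)
     (70 * (sqrt (2 ^ Suc k / 2 + dev_level k) + dev_level k / sqrt (2 ^ Suc k))) N)"

lemma dev_level_pos: "0 < dev_level k"
  unfolding dev_level_def using y by (simp add: add_pos_nonneg)

lemma dyadic_event_sets: "dyadic_event k \<in> sets P"
  and prob_dyadic_event_le: "prob (dyadic_event k) \<le> exp (- (2 * dev_level k))"
  unfolding dyadic_event_def
  by (intro prob_crossing_ever_le dev_level_pos; simp)+

lemma deviation_in_dyadic_event:
  assumes \<omega>: "\<omega> \<in> space P" and n: "1 \<le> n"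
    and dev: "Z_star P F X Y n \<omega> > 100 * (sqrt (gamma_star X n \<omega> + y + iota n)
              + (y + iota n) / sqrt (gamma_star X n \<omega>))"
  shows "\<exists>k. \<omega> \<in> dyadic_event k"
proof -
  define \<gamma> where "\<gamma> = gamma_star X n \<omega>"
  have Xn: "norm (X j \<omega>) \<le> 1" if "1 \<le> j" for j using norm_X[OF that \<omega>] .
  have \<gamma>1: "1 \<le> \<gamma>" unfolding \<gamma>_def by (rule gamma_star_ge_1) (rule Xn)
  obtain k where k: "2 ^ k \<le> \<gamma>" "\<gamma> < 2 ^ Suc k" using dyadic_interval[OF \<gamma>1] by blast
  define r :: real where "r = 2 ^ Suc k"
  define L where "L = dev_level k"
  define K where "K = 70 * (sqrt (r / 2 + L) + L / sqrt r)"
  have r: "2 \<le> r" "\<gamma> < r" "r \<le> 2 * \<gamma>" using k unfolding r_def by auto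
  have L: "0 < L" unfolding L_def by (rule dev_level_pos)
  have K: "0 < K" unfolding K_def using r L by (simp add: add_pos_pos)
  have gain: "info_gain (inverse r *\<^sub>R V_op X n \<omega>) \<le> r"
    using r(2) unfolding \<gamma>_def by (rule info_gain_le_of_gamma_star_less[rotated]) (rule Xn)
  have "4 ^ k \<le> n"
    using k(1) n unfolding \<gamma>_def by (rule power4_le_of_gamma_star_ge[rotated]) (rule Xn)
  then have L_le: "L \<le> y + iota n" unfolding L_def dev_level_def using iota_ge by simp
  \<comment> \<open>r / 2 <= \<gamma> serves under the root and \<gamma> < r in the denominator, so
    neither term of the threshold grows when passing from \<gamma> to r.\<close>
  have "sqrt (r / 2 + L) \<le> sqrt (\<gamma> + y + iota n)" using r L_le by simp
  moreover have "L / sqrt r \<le> (y + iota n) / sqrt \<gamma>"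
    using r L_le L \<gamma>1 by (intro frac_le) auto
  ultimately have "sqrt (r / 2 + L) + L / sqrt r \<le> sqrt (\<gamma> + y + iota n) + (y + iota n) / sqrt \<gamma>"
    by (rule add_mono)
  moreover have "100 / 70 * K = 100 * (sqrt (r / 2 + L) + L / sqrt r)" unfolding K_def by simp
  ultimately have "100 / 70 * K \<le> 100 * (sqrt (\<gamma> + y + iota n) + (y + iota n) / sqrt \<gamma>)"
    by (simp only: mult_le_cancel_left_pos zero_less_numeral)
  then have "100 / 70 * K < Z_star P F X Y n \<omega>" using dev unfolding \<gamma>_def by linarith
  then have "(100 / 70 * K)\<^sup>2 < (Z_star P F X Y n \<omega>)\<^sup>2" using K by (intro power_strict_mono) auto
  also have "\<dots> = M_sum X Y n \<omega> \<bullet> blinfun_apply (res \<gamma> n \<omega>) (M_sum X Y n \<omega>)"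
    unfolding Z_star_def \<gamma>_def[symmetric] by (rule Z_norm_sq) (use \<gamma>1 in simp)
  also have "\<dots> \<le> 2 * Z_sq r n \<omega>"
    unfolding Z_sq_def by (rule resolv_form_compare[OF cond_sq_nonneg]) (use r \<gamma>1 in auto)
  finally have "(100 / 70)\<^sup>2 * K\<^sup>2 < 2 * Z_sq r n \<omega>" by (simp only: power_mult_distrib)
  \<comment> \<open>Why 100 against 70: 100^2 >= 2 * 70^2 absorbs the factor 2 of
    \<open>resolv_form_compare\<close>.\<close>
  moreover have "2 * K\<^sup>2 \<le> (100 / 70)\<^sup>2 * K\<^sup>2" by (intro mult_right_mono) (auto simp: power2_eq_square)
  ultimately have "K\<^sup>2 < Z_sq r n \<omega>" by linarith
  then have "\<omega> \<in> crossing r K n" unfolding crossing_def using gain n \<omega> by auto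
  then show ?thesis unfolding dyadic_event_def r_def K_def L_def by blast
qed

lemma prob_Union_dyadic_event_le: "prob (\<Union>k. dyadic_event k) \<le> exp (- y)"
proof -
  define p where "p k = exp (- (2 * y + 2)) * (1 / (real k + 1)\<^sup>2)" for k
  have p: "exp (- (2 * dev_level k)) = p k" for k
  proof -
    have "exp (- (2 * dev_level k)) = exp (- (2 * y + 2)) * inverse ((exp (ln (1 + real k)))\<^sup>2)"
      unfolding dev_level_def power2_eq_square exp_add[symmetric] exp_minus[symmetric]
      by (simp add: algebra_simps)
    then show ?thesis unfolding p_def by (simp add: inverse_eq_divide add.commute)
  qed
  have sums: "p sums (exp (- (2 * y + 2)) * (pi\<^sup>2 / 6))"
    unfolding p_def by (rule sums_mult) (use inverse_squares_sums in \<open>simp add: add.commute\<close>)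
  have le: "prob (dyadic_event k) \<le> p k" for k using prob_dyadic_event_le[of k] p by simp
  have summ: "summable (\<lambda>k. prob (dyadic_event k))"
    using le by (intro summable_comparison_test'[OF sums_summable[OF sums]]) auto
  have "prob (\<Union>k. dyadic_event k) \<le> (\<Sum>k. prob (dyadic_event k))"
    using dyadic_event_sets by (intro finite_measure_subadditive_countably summ) auto
  also have "\<dots> \<le> exp (- (2 * y + 2)) * (pi\<^sup>2 / 6)"
    using suminf_le[OF le summ sums_summable[OF sums]] sums_unique[OF sums] by simp
  \<comment> \<open>The summand 1 in \<open>dev_level\<close> supplies the factor exp (-2) that
    outweighs the sum of 1 / (k + 1)^2.\<close>
  also have "pi\<^sup>2 / 6 \<le> exp 2"
  proof -
    have "pi\<^sup>2 \<le> 4\<^sup>2" using pi_less_4 pi_gt_zero by (intro power_mono) auto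
    then show ?thesis using exp_ge_add_one_self[of 2] by simp
  qed
  then have "exp (- (2 * y + 2)) * (pi\<^sup>2 / 6) \<le> exp (- (2 * y + 2)) * exp 2" by simp
  also have "\<dots> = exp (- (2 * y))" unfolding exp_add[symmetric] by simp
  also have "\<dots> \<le> exp (- y)" using y by simp
  finally show ?thesis .
qed

end

end

theorem mainTheorem2:
  fixes P :: "'w measure" and F :: "nat \<Rightarrow> 'w measure"
    and X :: "nat \<Rightarrow> 'w \<Rightarrow> 'a::{real_inner, banach, second_countable_topology}"
    and Y :: "nat \<Rightarrow> 'w \<Rightarrow> real"
    and y :: real
  assumes "prob_space P"
    and "filtration (space P) F"
    and "\<And>n. subalgebra P (F n)"
    and "\<And>n. n \<ge> 1 \<Longrightarrow> X n \<in> borel_measurable (F (n - 1))"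
    and "\<And>n \<omega>. n \<ge> 1 \<Longrightarrow> \<omega> \<in> space P \<Longrightarrow> X n \<omega> \<in> cball 0 1"
    and "\<And>n. n \<ge> 1 \<Longrightarrow> Y n \<in> borel_measurable (F n)"
    and "\<And>n. n \<ge> 1 \<Longrightarrow> AE \<omega> in P. real_cond_exp P (F (n - 1)) (Y n) \<omega> = 0"
    and "\<And>n. n \<ge> 1 \<Longrightarrow> AE \<omega> in P. \<bar>Y n \<omega>\<bar> \<le> 1"
    and "y > 0"
  defines "bad \<equiv> {\<omega> \<in> space P. \<exists>n\<ge>1. Z_star P F X Y n \<omega> >
      100 * (sqrt (gamma_star X n \<omega> + y + iota n)
              + (y + iota n) / sqrt (gamma_star X n \<omega>))}"
  shows "bad \<in> sets P \<and> measure P bad \<le> exp (- y)"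
proof -
  interpret self_normalized_martingale P F X Y
    using assms(1-8) by (intro self_normalized_martingale.intro self_normalized_martingale_axioms.intro)
  note [measurable] = Z_star_meas gamma_star_meas
  have "bad \<in> sets P" unfolding bad_def by measurable
  moreover have "bad \<subseteq> (\<Union>k. dyadic_event y k)"
    using deviation_in_dyadic_event[OF \<open>y > 0\<close>] unfolding bad_def by blast
  then have "prob bad \<le> prob (\<Union>k. dyadic_event y k)"
    using dyadic_event_sets[OF \<open>y > 0\<close>] by (intro finite_measure_mono) auto
  ultimately show ?thesis using prob_Union_dyadic_event_le[OF \<open>y > 0\<close>] by linarith
qed

end
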